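(* Let $\alpha>1$ and let $X$ be a log-concave real random variable. Then $$h_\alpha(X) \ \geq\ \tfrac12 \log \operatorname{Var}(X) + \frac{\log \alpha}{\alpha-1},$$ with equality when $X$ is an exponential random variable.
   Context: A real random variable $X$ is log-concave if it has a density (with respect to Lebesgue measure) of the form $f=e^{-V}$, where $V:\mathbb{R}\to(-\infty,\infty]$ is convex. For $\alpha\in(0,\infty)\setminus\{1\}$, the Rényi entropy of order $\alpha$ of a real random variable $X$ with density $f$ is $h_\alpha(X)=\frac{1}{1-\alpha}\log\left(\int f^\alpha(x)\,dx\right)$. Here $\log$ is the natural logarithm and $\operatorname{Var}$ denotes variance. *)

theory Defs
  imports "HOL-Probability.Probability"
begin

text \<open>The library's \<open>convex_on\<close> is for real-valued functions only. The inequality below uses the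
  \<open>ereal\<close> convention \<open>0 * \<infinity> = 0\<close>, which is harmless: for weights \<open>0\<close> and \<open>1\<close> it reads
  \<open>V x \<le> V x\<close>.\<close>

definition ereal_convex :: "(real \<Rightarrow> ereal) \<Rightarrow> bool" where
  "ereal_convex V \<longleftrightarrow>
     (\<forall>x. V x \<noteq> -\<infinity>) \<and>
     (\<forall>x y u v. 0 \<le> u \<longrightarrow> 0 \<le> v \<longrightarrow> u + v = 1 \<longrightarrow>
        V (u * x + v * y) \<le> ereal u * V x + ereal v * V y)"

text \<open>\<open>e\<^sup>-\<^sup>v\<close> for \<open>v\<close> in \<open>(-\<infinity>, \<infinity>]\<close>, with \<open>e\<^sup>-\<^sup>\<infinity> = 0\<close>; the value at \<open>-\<infinity>\<close> is never used.\<close>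

definition exp_neg :: "ereal \<Rightarrow> real" where
  "exp_neg v = (if v = \<infinity> then 0 else exp (- real_of_ereal v))"

definition log_concave_rv :: "'a measure \<Rightarrow> ('a \<Rightarrow> real) \<Rightarrow> bool" where
  "log_concave_rv M X \<longleftrightarrow>
     (\<exists>V. ereal_convex V \<and> distributed M lborel X (\<lambda>x. ennreal (exp_neg (V x))))"

text \<open>As in the library's \<open>entropy\<close>, the density of \<open>X\<close> is taken to be the Radon-Nikodym
  derivative of its law, so the value depends on \<open>X\<close> only; \<open>renyi_entropy_distributed\<close> shows that
  every density of \<open>X\<close> gives the same value. The definition is meaningful when the integral of
  \<open>f\<^sup>\<alpha>\<close> is finite, which holds for every log-concave \<open>X\<close> and every \<open>\<alpha> > 0\<close>.\<close>

definition renyi_entropy :: "real \<Rightarrow> 'a measure \<Rightarrow> ('a \<Rightarrow> real) \<Rightarrow> real" where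
  "renyi_entropy \<alpha> M X =
     1 / (1 - \<alpha>) * ln (\<integral>x. enn2real (RN_deriv lborel (distr M lborel X) x) powr \<alpha> \<partial>lborel)"

lemma renyi_entropy_distributed:
  fixes f :: "real \<Rightarrow> real"
  assumes X: "distributed M lborel X (\<lambda>x. ennreal (f x))" and nn: "\<And>x. 0 \<le> f x"
  shows "renyi_entropy \<alpha> M X = 1 / (1 - \<alpha>) * ln (\<integral>x. f x powr \<alpha> \<partial>lborel)"
proof -
  have m: "(\<lambda>x. ennreal (f x)) \<in> borel_measurable lborel"
    and d: "density lborel (\<lambda>x. ennreal (f x)) = distr M lborel X"
    using X by (auto simp: distributed_def)
  have ae: "AE x in lborel. ennreal (f x) = RN_deriv lborel (distr M lborel X) x"
    by (rule sigma_finite_measure.RN_deriv_unique[OF sigma_finite_lborel m d])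
  have mf: "f \<in> borel_measurable lborel"
    using borel_measurable_enn2real[OF m] nn by simp
  have "(\<integral>x. enn2real (RN_deriv lborel (distr M lborel X) x) powr \<alpha> \<partial>lborel)
      = (\<integral>x. f x powr \<alpha> \<partial>lborel)"
  proof (rule integral_cong_AE)
    show "AE x in lborel. enn2real (RN_deriv lborel (distr M lborel X) x) powr \<alpha> = f x powr \<alpha>"
      using ae
    proof eventually_elim
      case (elim x)
      then show ?case using nn[of x] by (simp flip: elim)
    qed
  qed (use mf in measurable)
  then show ?thesis by (simp add: renyi_entropy_def)
qed

lemma log_concave_rv_exponential:
  assumes "0 < l" and X: "distributed M lborel X (exponential_density l)"
  shows "log_concave_rv M X"
proof -
  define V where "V x = (if x < 0 then \<infinity> else ereal (x * l - ln l))" for x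
  have "V (u * x + v * y) \<le> ereal u * V x + ereal v * V y"
    if uv: "0 \<le> u" "0 \<le> v" "u + v = 1" for x y u v
  proof (cases "(u = 0 \<or> v = 0) \<or> x < 0 \<or> y < 0")
    case True
    with uv show ?thesis by (auto simp: V_def zero_ereal_def[symmetric] one_ereal_def[symmetric])
  next
    case False
    then have "0 \<le> u * x + v * y" using uv by simp
    moreover have "ln l = u * ln l + v * ln l"
      using uv by (simp flip: distrib_right)
    ultimately show ?thesis using False by (simp add: V_def algebra_simps)
  qed
  then have "ereal_convex V"
    by (auto simp: ereal_convex_def V_def)
  moreover have "exp_neg (V x) = exponential_density l x" for x
    using assms(1) by (simp add: V_def exp_neg_def exponential_density_def exp_diff exp_minus field_simps)
  ultimately show ?thesis
    using X unfolding log_concave_rv_def by (intro exI[of _ V]) simp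
qed

end

theory Submission
  imports Defs
begin

text \<open>
  Let \<open>f\<close> be the density and \<open>b = \<alpha> - 1\<close>. The inequality says that
  \<open>(1 + b) \<integral> f\<^bsup>1+b\<^esup> \<le> t\<^bsup>-b\<^esup>\<close> when \<open>t\<close> is the standard deviation. The right side decreases in \<open>t\<close>,
  so it suffices to find some \<open>t\<close> that is at least the standard deviation and satisfies it.

  Reduction to decreasing densities. The superlevel sets of \<open>f\<close> are nested bounded intervals. Replacing
  each of them by an interval of the same length that starts at \<open>0\<close> turns \<open>f\<close> into a decreasing density
  on the half-line. This keeps \<open>\<integral> f\<^bsup>1+b\<^esup>\<close>, keeps log-concavity (\<open>rearr_concave\<close>), and does not
  decrease the variance: for nested intervals the midpoints differ by at most half the difference of the
  lengths, with equality for intervals with a common left end. The form used is \<open>second_moment_le_rearr\<close>: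
  every second moment of the rearranged density bounds some second moment of \<open>f\<close>.

  Decreasing densities. Let \<open>F\<close> be a decreasing log-concave density on the half-line, and let
  \<open>Q\<close>, \<open>G\<close>, \<open>H\<close> be its iterated tail integrals, so that \<open>G 0\<close> is the mean and \<open>H 0\<close> half the second
  moment. Choose \<open>t = H 0 / G 0\<close>. The second moment about the point \<open>t\<close> is then exactly \<open>t\<^sup>2\<close>, which
  bounds the variance. What remains is \<open>(1 + b) \<integral> F\<^bsup>1+b\<^esup> \<le> (G 0 / H 0)\<^bsup>b\<^esup>\<close>, and it is proved from
  infinity inwards: for every \<open>x\<close>, the integral of \<open>(1 + b) F\<^bsup>1+b\<^esup>\<close> over the half-line from \<open>x\<close> is at most
  \<open>U = Q\<^bsup>1+b\<^esup> (Q/G)\<^bsup>b\<^esup> exp (b (1 - w))\<close> with \<open>w = H Q / G\<^sup>2\<close>. For exponential densities \<open>w = 1\<close> and both sides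
  agree. In general the integral vanishes at infinity, \<open>U\<close> is nonnegative, and the derivative of \<open>U\<close> is at
  most that of the integral. The last point is an inequality between the two numbers \<open>y = Q\<^sup>2 / (F G)\<close> and
  \<open>w\<close>, valid because \<open>1 \<le> y \<le> 2\<close> and \<open>2/3 \<le> w \<le> 1\<close> (\<open>comparison_derivative_bound\<close>); log-concavity
  gives the bounds with \<open>1\<close>, monotonicity of \<open>F\<close> the other two. Finally \<open>exp (1 - w) \<le> 1 / w\<close> turns
  \<open>U\<close> into \<open>Q\<^bsup>1+b\<^esup> (G/H)\<^bsup>b\<^esup>\<close>, which at \<open>x = 0\<close> is the claim.
\<close>

section \<open>Tail integrals\<close>

definition tail :: "(real \<Rightarrow> real) \<Rightarrow> real \<Rightarrow> real" where
  "tail \<phi> x = (LINT u:{x..}|lborel. \<phi> u)"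

context
  fixes \<phi> :: "real \<Rightarrow> real"
  assumes int: "set_integrable lborel {0..} \<phi>"
    and nn: "\<And>u. 0 \<le> \<phi> u"
begin

lemma set_integrable_tail:
  assumes "0 \<le> x"
  shows "set_integrable lborel {x..} \<phi>"
  using assms by (intro set_integrable_subset[OF int]) auto

lemma tail_nonneg: "0 \<le> tail \<phi> x"
  unfolding tail_def set_lebesgue_integral_def by (rule Bochner_Integration.integral_nonneg) (simp add: nn)

lemma nn_integral_tail:
  assumes "0 \<le> x"
  shows "(\<integral>\<^sup>+u\<in>{x..}. ennreal (\<phi> u) \<partial>lborel) = ennreal (tail \<phi> x)"
proof -
  have "(\<integral>\<^sup>+u\<in>{x..}. ennreal (\<phi> u) \<partial>lborel) = (\<integral>\<^sup>+u. ennreal (indicator {x..} u *\<^sub>R \<phi> u) \<partial>lborel)"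
    by (intro nn_integral_cong) (auto simp: indicator_def)
  also have "\<dots> = ennreal (tail \<phi> x)"
    unfolding tail_def set_lebesgue_integral_def
    using set_integrable_tail[OF assms] nn
    by (intro nn_integral_eq_integral) (auto simp: set_integrable_def)
  finally show ?thesis .
qed

lemma tail_split:
  assumes "0 \<le> x" "x \<le> y"
  shows "\<phi> integrable_on {x..y}" "tail \<phi> x = integral {x..y} \<phi> + tail \<phi> y"
proof -
  have i: "set_integrable lborel {x..y} \<phi>"
    using assms by (intro set_integrable_subset[OF int]) auto
  show "\<phi> integrable_on {x..y}"
    using set_borel_integral_eq_integral(1)[OF i] .
  have "{x..} = {x..y} \<union> {y..}" using assms by auto
  moreover have "AE u in lborel. \<not> (u \<in> {x..y} \<and> u \<in> {y..})"
    using AE_lborel_singleton[of y] by eventually_elim auto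
  ultimately have "tail \<phi> x = (LINT u:{x..y}|lborel. \<phi> u) + tail \<phi> y"
    unfolding tail_def using i set_integrable_tail[of y] assms
    by (simp add: set_integral_Un_AE)
  then show "tail \<phi> x = integral {x..y} \<phi> + tail \<phi> y"
    using set_borel_integral_eq_integral(2)[OF i] by simp
qed

lemma tail_antimono:
  assumes "0 \<le> x" "x \<le> y"
  shows "tail \<phi> y \<le> tail \<phi> x"
  using tail_split[OF assms] integral_nonneg[of \<phi> "{x..y}"] nn by auto

lemma continuous_on_tail: "continuous_on {0..} (tail \<phi>)"
  unfolding continuous_on_eq_continuous_within
proof
  fix x :: real assume x: "x \<in> {0..}"
  have "continuous_on {0..x+1} (\<lambda>y. tail \<phi> 0 - integral {0..y} \<phi>)"
    using tail_split(1)[of 0 "x+1"] x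
    by (intro continuous_intros indefinite_integral_continuous_1) auto
  then have "continuous_on {0..x+1} (tail \<phi>)"
    by (rule continuous_on_eq) (use tail_split(2)[of 0] in auto)
  then have "continuous (at x within {0..x+1}) (tail \<phi>)"
    using x by (auto simp: continuous_on_eq_continuous_within)
  moreover have "at x within {0..x+1} = at x within {0..}"
    by (rule at_within_nhd[of x "{..<x+1}"]) auto
  ultimately show "continuous (at x within {0..}) (tail \<phi>)"
    by simp
qed

lemma tail_has_derivative:
  assumes "open S" "x \<in> S" "S \<subseteq> {0<..}" "continuous_on S \<phi>"
  shows "(tail \<phi> has_real_derivative - \<phi> x) (at x)"
proof -
  obtain e where e: "0 < e" "cball x e \<subseteq> S"
    using assms by (meson open_contains_cball)
  have sub: "{x-e..x+e} \<subseteq> S" using e by (simp add: cball_eq_atLeastAtMost)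
  then have pos: "0 < x - e" using assms(3) e(1) by force
  have "((\<lambda>y. integral {x-e..y} \<phi>) has_real_derivative \<phi> x) (at x within {x-e..x+e})"
    using e by (intro integral_has_real_derivative continuous_on_subset[OF assms(4) sub]) auto
  then have "((\<lambda>y. integral {x-e..y} \<phi>) has_real_derivative \<phi> x) (at x within {x-e<..<x+e})"
    by (rule DERIV_subset) auto
  then have "((\<lambda>y. integral {x-e..y} \<phi>) has_real_derivative \<phi> x) (at x)"
    using e at_within_open[of x "{x-e<..<x+e}"] by simp
  then have "((\<lambda>y. tail \<phi> (x-e) - integral {x-e..y} \<phi>) has_real_derivative - \<phi> x) (at x)"
    using DERIV_diff[OF DERIV_const] by fastforce
  then show ?thesis
  proof (rule has_field_derivative_transform_within_open[where S = "{x-e<..<x+e}"])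
    fix y assume "y \<in> {x-e<..<x+e}"
    then show "tail \<phi> (x - e) - integral {x - e..y} \<phi> = tail \<phi> y"
      using tail_split(2)[of "x-e" y] pos by simp
  qed (use e in auto)
qed

lemma tail_tendsto_0: "(tail \<phi> \<longlongrightarrow> 0) at_top"
proof -
  have "((\<lambda>y. LINT u:{0..y}|lborel. \<phi> u) \<longlongrightarrow> (LINT u:{0..}|lborel. \<phi> u)) at_top"
    by (rule tendsto_set_lebesgue_integral_at_top[OF _ int]) auto
  then have a: "((\<lambda>y. tail \<phi> 0 - (LINT u:{0..y}|lborel. \<phi> u)) \<longlongrightarrow> tail \<phi> 0 - tail \<phi> 0) at_top"
    unfolding tail_def by (intro tendsto_intros)
  have b: "eventually (\<lambda>y. tail \<phi> 0 - (LINT u:{0..y}|lborel. \<phi> u) = tail \<phi> y) at_top"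
    using eventually_ge_at_top[of 0]
  proof eventually_elim
    case (elim y)
    have "set_integrable lborel {0..y} \<phi>" by (rule set_integrable_subset[OF int]) auto
    then show ?case
      using tail_split(2)[of 0 y] elim set_borel_integral_eq_integral(2) by fastforce
  qed
  show ?thesis
    using Lim_transform_eventually[OF a b] by simp
qed

text \<open>Exchanging the order of integration moves the tail operation from the function to the weight.
  With powers as weights this shows that iterated tails are moments, see \<open>nn_integral_tail_moment\<close>.\<close>

lemma nn_integral_weighted_tail:
  fixes k :: "real \<Rightarrow> real"
  assumes "0 \<le> x" and [measurable]: "k \<in> borel_measurable borel"
  shows "(\<integral>\<^sup>+u\<in>{x..}. ennreal (k u) * ennreal (tail \<phi> u) \<partial>lborel)
    = (\<integral>\<^sup>+v\<in>{x..}. (\<integral>\<^sup>+u\<in>{x..v}. ennreal (k u) \<partial>lborel) * ennreal (\<phi> v) \<partial>lborel)"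
proof -
  define p where "p v = ennreal (indicator {0..} v * \<phi> v)" for v
  have [measurable]: "p \<in> borel_measurable borel"
    using int unfolding p_def set_integrable_def by simp
  have "(\<integral>\<^sup>+u\<in>{x..}. ennreal (k u) * ennreal (tail \<phi> u) \<partial>lborel)
     = (\<integral>\<^sup>+u. \<integral>\<^sup>+v. ennreal (k u) * p v * indicator {(u, v). x \<le> u \<and> u \<le> v} (u, v) \<partial>lborel \<partial>lborel)"
  proof (rule nn_integral_cong)
    fix u :: real
    show "ennreal (k u) * ennreal (tail \<phi> u) * indicator {x..} u
      = (\<integral>\<^sup>+v. ennreal (k u) * p v * indicator {(u, v). x \<le> u \<and> u \<le> v} (u, v) \<partial>lborel)"
    proof (cases "x \<le> u")
      case True
      then have "ennreal (k u) * ennreal (tail \<phi> u) * indicator {x..} u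
        = ennreal (k u) * (\<integral>\<^sup>+v\<in>{u..}. ennreal (\<phi> v) \<partial>lborel)"
        using assms(1) by (simp add: nn_integral_tail)
      also have "(\<integral>\<^sup>+v\<in>{u..}. ennreal (\<phi> v) \<partial>lborel) = (\<integral>\<^sup>+v\<in>{u..}. p v \<partial>lborel)"
        using True assms(1) by (intro nn_integral_cong) (auto simp: p_def indicator_def)
      also have "ennreal (k u) * \<dots> = (\<integral>\<^sup>+v. ennreal (k u) * (p v * indicator {u..} v) \<partial>lborel)"
        by (simp add: nn_integral_cmult)
      finally show ?thesis using True
        by (auto simp: indicator_def mult.assoc intro!: nn_integral_cong)
    qed simp
  qed
  also have "\<dots> = (\<integral>\<^sup>+v. \<integral>\<^sup>+u. ennreal (k u) * p v * indicator {(u, v). x \<le> u \<and> u \<le> v} (u, v) \<partial>lborel \<partial>lborel)"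
    by (rule lborel_pair.Fubini'[symmetric]) measurable
  also have "\<dots> = (\<integral>\<^sup>+v\<in>{x..}. (\<integral>\<^sup>+u\<in>{x..v}. ennreal (k u) \<partial>lborel) * ennreal (\<phi> v) \<partial>lborel)"
  proof (rule nn_integral_cong)
    fix v :: real
    have "(\<integral>\<^sup>+u. ennreal (k u) * p v * indicator {(u, v). x \<le> u \<and> u \<le> v} (u, v) \<partial>lborel)
       = (\<integral>\<^sup>+u. (ennreal (k u) * indicator {x..v} u) * p v \<partial>lborel)"
      by (intro nn_integral_cong) (auto simp: indicator_def)
    also have "\<dots> = (\<integral>\<^sup>+u\<in>{x..v}. ennreal (k u) \<partial>lborel) * p v"
      by (rule nn_integral_multc) measurable
    also have "\<dots> = (\<integral>\<^sup>+u\<in>{x..v}. ennreal (k u) \<partial>lborel) * ennreal (\<phi> v) * indicator {x..} v"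
      using assms(1) by (cases "x \<le> v") (auto simp: p_def)
    finally show "(\<integral>\<^sup>+u. ennreal (k u) * p v * indicator {(u, v). x \<le> u \<and> u \<le> v} (u, v) \<partial>lborel)
       = (\<integral>\<^sup>+u\<in>{x..v}. ennreal (k u) \<partial>lborel) * ennreal (\<phi> v) * indicator {x..} v" .
  qed
  finally show ?thesis .
qed

end

lemma tail_cmult: "tail (\<lambda>u. c * \<phi> u) x = c * tail \<phi> x"
  unfolding tail_def by simp

lemma tail_mono:
  assumes "set_integrable lborel {x..} \<phi>" "set_integrable lborel {x..} \<psi>"
    and "\<And>u. x \<le> u \<Longrightarrow> \<phi> u \<le> \<psi> u"
  shows "tail \<phi> x \<le> tail \<psi> x"
  unfolding tail_def by (rule set_integral_mono) (use assms in auto)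

lemma tail_shift:
  assumes "set_integrable lborel {x + h..} \<phi>"
  shows "set_integrable lborel {x..} (\<lambda>u. \<phi> (u + h))"
    and "tail \<phi> (x + h) = tail (\<lambda>u. \<phi> (u + h)) x"
proof -
  have eq: "indicator {x + h..} (h + 1 * u) *\<^sub>R \<phi> (h + 1 * u) = indicator {x..} u *\<^sub>R \<phi> (u + h)" for u
    by (auto simp: indicator_def add.commute)
  show "set_integrable lborel {x..} (\<lambda>u. \<phi> (u + h))"
    using lborel_integrable_real_affine[OF assms[unfolded set_integrable_def], of 1 h]
    unfolding set_integrable_def eq by simp
  show "tail \<phi> (x + h) = tail (\<lambda>u. \<phi> (u + h)) x"
    unfolding tail_def set_lebesgue_integral_def
    using lborel_integral_real_affine[of 1 "\<lambda>u. indicator {x + h..} u *\<^sub>R \<phi> u" h]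
    unfolding eq by simp
qed

text \<open>The hypothesis \<open>lc\<close> is log-concavity of \<open>\<phi>\<close> in multiplicative form: of two pairs of points with the
  same sum, the inner pair has the larger product. Integrating it over \<open>w\<close> shows that the hazard rate
  \<open>\<phi> / tail \<phi>\<close> increases; the product form also covers points where the tail vanishes.\<close>

lemma tail_hazard_mono:
  assumes int: "set_integrable lborel {0..} \<phi>"
    and lc: "\<And>a b w. 0 < a \<Longrightarrow> a \<le> b \<Longrightarrow> 0 \<le> w \<Longrightarrow> \<phi> a * \<phi> (b + w) \<le> \<phi> b * \<phi> (a + w)"
    and ab: "0 < a" "a \<le> b"
  shows "\<phi> a * tail \<phi> b \<le> \<phi> b * tail \<phi> a"
proof -
  have ia: "set_integrable lborel {a..} \<phi>" and ib: "set_integrable lborel {a + (b - a)..} \<phi>"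
    using ab by (auto intro!: set_integrable_subset[OF int])
  have "tail (\<lambda>u. \<phi> a * \<phi> (u + (b - a))) a \<le> tail (\<lambda>u. \<phi> b * \<phi> u) a"
  proof (rule tail_mono)
    fix u assume "a \<le> u"
    then show "\<phi> a * \<phi> (u + (b - a)) \<le> \<phi> b * \<phi> u"
      using lc[OF ab, of "u - a"] by (simp add: algebra_simps)
  qed (use ia tail_shift(1)[OF ib] in auto)
  then show ?thesis
    using tail_shift(2)[OF ib] by (simp add: tail_cmult)
qed

text \<open>Monotone ratios pass from \<open>\<phi>, tail \<phi>\<close> to the next pair of iterated tails. Integrating the hypothesis over
  \<open>b\<close> gives the first claim, and integrating the first claim over \<open>a\<close> the second.\<close>

lemma tail_ratio_step:
  assumes int: "set_integrable lborel {0..} \<phi>" and nn: "\<And>u. 0 \<le> \<phi> u"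
    and int': "set_integrable lborel {0..} (tail \<phi>)"
    and r: "\<And>a b. 0 < a \<Longrightarrow> a \<le> b \<Longrightarrow> \<phi> a * tail \<phi> b \<le> \<phi> b * tail \<phi> a"
    and ab: "0 < a" "a \<le> b"
  shows "\<phi> a * tail (tail \<phi>) b \<le> tail \<phi> b * tail \<phi> a"
    and "tail \<phi> a * tail (tail \<phi>) b \<le> tail \<phi> b * tail (tail \<phi>) a"
proof -
  have *: "\<phi> c * tail (tail \<phi>) b \<le> tail \<phi> b * tail \<phi> c" if c: "0 < c" "c \<le> b" for c
  proof -
    have "tail (\<lambda>u. \<phi> c * tail \<phi> u) b \<le> tail (\<lambda>u. tail \<phi> c * \<phi> u) b"
      using c r[of c] set_integrable_tail[OF int nn, of b] set_integrable_tail[OF int' tail_nonneg[OF int nn], of b]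
      by (intro tail_mono) (auto simp: mult.commute)
    then show ?thesis by (simp only: tail_cmult) (simp only: mult.commute)
  qed
  show "\<phi> a * tail (tail \<phi>) b \<le> tail \<phi> b * tail \<phi> a" using * ab by simp
  note s1 = tail_split[OF int nn, of a b] and s2 = tail_split[OF int' tail_nonneg[OF int nn], of a b]
  have "integral {a..b} (\<lambda>c. \<phi> c * tail (tail \<phi>) b) \<le> integral {a..b} (\<lambda>c. tail \<phi> b * tail \<phi> c)"
    using ab s1(1) s2(1) *
    by (intro integral_le integrable_on_mult_left integrable_on_mult_right) auto
  then have "integral {a..b} \<phi> * tail (tail \<phi>) b \<le> tail \<phi> b * integral {a..b} (tail \<phi>)"
    by simp
  then show "tail \<phi> a * tail (tail \<phi>) b \<le> tail \<phi> b * tail (tail \<phi>) a"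
    using s1(2) s2(2) ab by (simp add: algebra_simps)
qed

text \<open>Beyond \<open>z\<close> the increasing hazard rate bounds the tail by a multiple of \<open>\<phi>\<close> itself, so integrability is
  inherited by the tail; this makes all moments finite.\<close>

lemma set_integrable_tail_tail:
  assumes int: "set_integrable lborel {0..} \<phi>" and nn: "\<And>u. 0 \<le> \<phi> u"
    and r: "\<And>a b. 0 < a \<Longrightarrow> a \<le> b \<Longrightarrow> \<phi> a * tail \<phi> b \<le> \<phi> b * tail \<phi> a"
    and z: "0 < z" "0 < \<phi> z"
  shows "set_integrable lborel {0..} (tail \<phi>)"
proof (rule set_integrable_bound)
  have "set_integrable lborel {0..} (\<lambda>u. indicator {0..z} u *\<^sub>R tail \<phi> 0)"
    unfolding set_integrable_def
    by (rule integrableI_bounded_set[of "{0..z}" _ _ "\<bar>tail \<phi> 0\<bar>"]) (auto simp: indicator_def emeasure_lborel_Icc_eq)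
  then show "set_integrable lborel {0..} (\<lambda>u. indicator {0..z} u *\<^sub>R tail \<phi> 0 + tail \<phi> z / \<phi> z * \<phi> u)"
    using int by (intro set_integral_add) auto
  show "set_borel_measurable lborel {0..} (tail \<phi>)"
    using borel_measurable_continuous_on_indicator[OF _ continuous_on_tail[OF int nn]]
    by (simp add: set_borel_measurable_def)
  show "AE u in lborel. u \<in> {0..} \<longrightarrow> norm (tail \<phi> u) \<le>
      norm (indicator {0..z} u *\<^sub>R tail \<phi> 0 + tail \<phi> z / \<phi> z * \<phi> u)"
  proof (intro AE_I2 impI)
    fix u :: real assume u: "u \<in> {0..}"
    have nt: "0 \<le> tail \<phi> v" for v by (rule tail_nonneg[OF int nn])
    have nc: "0 \<le> tail \<phi> z / \<phi> z * \<phi> u" using nt nn z by simp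
    have "tail \<phi> u \<le> indicator {0..z} u *\<^sub>R tail \<phi> 0 + tail \<phi> z / \<phi> z * \<phi> u"
    proof (cases "u \<le> z")
      case True
      then show ?thesis using u nc tail_antimono[OF int nn, of 0 u] by simp
    next
      case False
      then have "\<phi> z * tail \<phi> u \<le> \<phi> u * tail \<phi> z" using r[of z u] z by simp
      then show ?thesis using False z by (simp add: field_simps)
    qed
    then show "norm (tail \<phi> u) \<le> norm (indicator {0..z} u *\<^sub>R tail \<phi> 0 + tail \<phi> z / \<phi> z * \<phi> u)"
      using nt[of u] by simp
  qed
qed

text \<open>A function that is at most \<open>\<phi> x\<close> beyond \<open>x\<close> has a tail above the line of slope \<open>- \<phi> x\<close> through
  \<open>tail \<phi> x\<close>. The claim compares the area under the tail with that of the triangle under this line.\<close>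

lemma tail_square_le:
  assumes int: "set_integrable lborel {0..} \<phi>" and nn: "\<And>u. 0 \<le> \<phi> u"
    and int': "set_integrable lborel {0..} (tail \<phi>)"
    and anti: "\<And>u. x \<le> u \<Longrightarrow> \<phi> u \<le> \<phi> x" and x: "0 \<le> x" "0 < \<phi> x"
  shows "(tail \<phi> x)\<^sup>2 \<le> 2 * \<phi> x * tail (tail \<phi>) x"
proof -
  define h where "h = tail \<phi> x / \<phi> x"
  have h: "0 \<le> h" using tail_nonneg[OF int nn] x by (simp add: h_def)
  have lower: "tail \<phi> x - \<phi> x * (u - x) \<le> tail \<phi> u" if "x \<le> u" for u
  proof -
    have "integral {x..u} \<phi> \<le> integral {x..u} (\<lambda>_. \<phi> x)"
      using tail_split(1)[OF int nn, of x u] x that anti by (intro integral_le) auto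
    then show ?thesis using tail_split(2)[OF int nn x(1) that] that by (simp add: mult.commute)
  qed
  have prim: "((\<lambda>u. tail \<phi> x - \<phi> x * (u - x)) has_integral
      (tail \<phi> x * (x + h) - \<phi> x * (x + h - x)\<^sup>2 / 2) - (tail \<phi> x * x - \<phi> x * (x - x)\<^sup>2 / 2)) {x..x + h}"
    using h
    by (intro fundamental_theorem_of_calculus)
      (auto intro!: derivative_eq_intros simp: has_real_derivative_iff_has_vector_derivative[symmetric])
  then have "tail \<phi> x * h - \<phi> x * h\<^sup>2 / 2 = integral {x..x+h} (\<lambda>u. tail \<phi> x - \<phi> x * (u - x))"
    by (simp add: integral_unique algebra_simps)
  also have "\<dots> \<le> integral {x..x+h} (tail \<phi>)"
    using prim tail_split(1)[OF int' tail_nonneg[OF int nn], of x "x+h"] x h lower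
    by (intro integral_le) auto
  also have "\<dots> \<le> tail (tail \<phi>) x"
    using tail_split(2)[OF int' tail_nonneg[OF int nn], of x "x+h"]
      tail_nonneg[OF int' tail_nonneg[OF int nn], of "x+h"] x h by simp
  finally have "(tail \<phi> x)\<^sup>2 / (2 * \<phi> x) \<le> tail (tail \<phi>) x"
    using x by (simp add: h_def power2_eq_square field_simps)
  then show ?thesis using x by (simp add: field_simps)
qed

lemma measurable_ennreal_indicator:
  assumes "set_integrable lborel A \<phi>"
  shows "(\<lambda>u. ennreal (\<phi> u) * indicator A u) \<in> borel_measurable lborel"
proof -
  have "(\<lambda>u. ennreal (indicator A u *\<^sub>R \<phi> u)) \<in> borel_measurable lborel"
    using assms unfolding set_integrable_def by simp
  then show ?thesis
    by (rule measurable_cong[THEN iffD1, rotated]) (auto simp: indicator_def)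
qed

lemma nn_integral_power_interval:
  fixes x v :: real
  assumes "x \<le> v"
  shows "(\<integral>\<^sup>+u\<in>{x..v}. ennreal ((u - x) ^ k) \<partial>lborel) = ennreal ((v - x) ^ Suc k / (Suc k))"
proof -
  have "(\<integral>\<^sup>+u. ennreal ((u - x) ^ k) * indicator {x..v} u \<partial>lborel)
     = ennreal ((v - x) ^ Suc k / (Suc k) - (x - x) ^ Suc k / (Suc k))"
    using assms
    by (intro nn_integral_FTC_Icc)
      (auto intro!: derivative_eq_intros simp del: power_Suc of_nat_Suc)
  then show ?thesis by simp
qed

lemma nn_integral_tail_moment:
  assumes int: "set_integrable lborel {0..} \<phi>" and nn: "\<And>u. 0 \<le> \<phi> u" and x: "0 \<le> x"
  shows "(\<integral>\<^sup>+u\<in>{x..}. ennreal ((u - x) ^ k * tail \<phi> u) \<partial>lborel)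
    = (\<integral>\<^sup>+v\<in>{x..}. ennreal ((v - x) ^ Suc k / Suc k * \<phi> v) \<partial>lborel)"
proof -
  have "(\<integral>\<^sup>+u\<in>{x..}. ennreal ((u - x) ^ k * tail \<phi> u) \<partial>lborel)
    = (\<integral>\<^sup>+u\<in>{x..}. ennreal ((u - x) ^ k) * ennreal (tail \<phi> u) \<partial>lborel)"
    using tail_nonneg[OF int nn]
    by (intro nn_integral_cong) (auto simp: indicator_def ennreal_mult)
  also have "\<dots> = (\<integral>\<^sup>+v\<in>{x..}. (\<integral>\<^sup>+u\<in>{x..v}. ennreal ((u - x) ^ k) \<partial>lborel) * ennreal (\<phi> v) \<partial>lborel)"
    by (rule nn_integral_weighted_tail[OF int nn x]) measurable
  also have "\<dots> = (\<integral>\<^sup>+v\<in>{x..}. ennreal ((v - x) ^ Suc k / Suc k * \<phi> v) \<partial>lborel)"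
  proof (rule nn_integral_cong)
    fix v :: real
    show "(\<integral>\<^sup>+u\<in>{x..v}. ennreal ((u - x) ^ k) \<partial>lborel) * ennreal (\<phi> v) * indicator {x..} v
      = ennreal ((v - x) ^ Suc k / Suc k * \<phi> v) * indicator {x..} v"
    proof (cases "x \<le> v")
      case True
      have "0 \<le> (v - x) ^ Suc k / real (Suc k)" using True by simp
      then show ?thesis
        using True nn[of v] unfolding nn_integral_power_interval[OF True]
        by (simp only: ennreal_mult)
    qed simp
  qed
  finally show ?thesis .
qed

section \<open>The pointwise inequality\<close>

text \<open>The chord of the logarithm over \<open>[1, 2]\<close> has slope \<open>ln 2 \<ge> 2/3\<close>.\<close>

lemma ln_ge_chord:
  fixes x :: real
  assumes "1 \<le> x" "x \<le> 2"
  shows "2 / 3 * (x - 1) \<le> ln x"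
proof -
  have "(1 - (x - 1)) * ln 1 + (x - 1) * ln 2 \<le> ln ((1 - (x - 1)) *\<^sub>R 1 + (x - 1) *\<^sub>R 2 :: real)"
    using assms by (intro concave_onD[OF ln_concave]) auto
  then have "(x - 1) * ln 2 \<le> ln x" by (simp add: algebra_simps)
  moreover have "(x - 1) * (2 / 3) \<le> (x - 1) * ln 2"
    using assms ln2_ge_two_thirds by (intro mult_left_mono) auto
  ultimately show ?thesis by simp
qed

lemma exp_mult_ge:
  fixes b v :: real
  assumes "0 \<le> v" "v \<le> b"
  shows "1 + b \<le> exp v * (1 + b - v)"
proof -
  have "1 + b \<le> (1 + v) * (1 + b - v)"
    using mult_nonneg_nonneg[of v "b - v"] assms by (simp add: algebra_simps)
  also have "\<dots> \<le> exp v * (1 + b - v)"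
    using assms by (intro mult_right_mono) auto
  finally show ?thesis .
qed

text \<open>The bound \<open>U = q\<^bsup>1+b\<^esup> (q/g)\<^bsup>b\<^esup> exp (b (1 - h q / g\<^sup>2))\<close>, written as one exponential so that its logarithmic
  derivative can be read off.\<close>

definition comparison :: "real \<Rightarrow> real \<Rightarrow> real \<Rightarrow> real \<Rightarrow> real" where
  "comparison b q g h = exp ((1 + 2 * b) * ln q - b * ln g + b * (1 - h * q / g\<^sup>2))"

text \<open>The left side is the derivative of \<open>comparison b q g h\<close> along \<open>q' = - f\<close>, \<open>g' = - q\<close>, \<open>h' = - g\<close>.
  With \<open>y = q\<^sup>2 / (f g)\<close>, \<open>d = 1 - h q / g\<^sup>2\<close> and \<open>c = d (2 y - 1)\<close> it equals
  \<open>- f\<^bsup>1+b\<^esup> exp (b (ln y + d)) (1 + b - b c)\<close>. The chord bound and \<open>d \<le> 1/3\<close> give \<open>c \<le> ln y + d\<close>, and then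
  \<open>exp_mult_ge\<close> applies to \<open>v = b c\<close>.\<close>

lemma comparison_derivative_bound:
  fixes f q g h b :: real
  assumes pos: "0 < f" "0 < q" "0 < g" "0 < b"
    and fg: "f * g \<le> q\<^sup>2" "q\<^sup>2 \<le> 2 * f * g"
    and hq: "h * q \<le> g\<^sup>2" "2 * g\<^sup>2 \<le> 3 * h * q"
  shows "comparison b q g h * (- (1 + 2 * b) * f / q + b * q / g
      - b * (2 * h * q\<^sup>2 / g ^ 3 - q / g - h * f / g\<^sup>2)) \<le> - ((1 + b) * f powr (1 + b))"
proof -
  define y where "y = q\<^sup>2 / (f * g)"
  define d where "d = 1 - h * q / g\<^sup>2"
  define c where "c = d * (2 * y - 1)"
  have y: "1 \<le> y" "y \<le> 2" using pos fg by (auto simp: y_def field_simps)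
  have d: "0 \<le> d" "d \<le> 1 / 3" using pos hq by (auto simp: d_def field_simps)
  have "c \<le> 1 / 3 * 3" unfolding c_def using y d by (intro mult_mono) auto
  moreover have "0 \<le> c" using y d by (simp add: c_def)
  ultimately have c: "0 \<le> c" "c \<le> 1" by auto
  have "c - d = 2 * d * (y - 1)" by (simp add: c_def algebra_simps)
  also have "\<dots> \<le> 2 * (1 / 3) * (y - 1)" using y d by (intro mult_right_mono mult_left_mono) auto
  also have "\<dots> \<le> ln y" using ln_ge_chord[OF y] by simp
  finally have cy: "c \<le> ln y + d" by simp
  have "- (1 + 2 * b) * f / q + b * q / g - b * (2 * h * q\<^sup>2 / g ^ 3 - q / g - h * f / g\<^sup>2)
      = - (f / q * (1 + b - b * c))"
    using pos by (simp add: c_def d_def y_def field_simps power2_eq_square power3_eq_cube)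
  moreover have "comparison b q g h * (f / q) = f powr (1 + b) * exp (b * (ln y + d))"
  proof -
    have ly: "ln y = 2 * ln q - ln f - ln g"
      using pos by (simp add: y_def ln_div ln_mult ln_realpow)
    have "comparison b q g h * (f / q) = exp ((1 + 2 * b) * ln q - b * ln g + b * d) * exp (ln f - ln q)"
      using pos by (simp add: comparison_def d_def exp_diff)
    also have "\<dots> = f powr (1 + b) * exp (b * (ln y + d))"
      using pos by (simp add: powr_def ly exp_add[symmetric] algebra_simps)
    finally show ?thesis .
  qed
  ultimately have "comparison b q g h * (- (1 + 2 * b) * f / q + b * q / g
      - b * (2 * h * q\<^sup>2 / g ^ 3 - q / g - h * f / g\<^sup>2))
     = - (f powr (1 + b) * (exp (b * (ln y + d)) * (1 + b - b * c)))"
    by (metis (no_types, opaque_lifting) mult.assoc mult_minus_right)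
  moreover have "1 + b \<le> exp (b * (ln y + d)) * (1 + b - b * c)"
  proof -
    have bc: "b * c \<le> b" using c pos by simp
    have "1 + b \<le> exp (b * c) * (1 + b - b * c)"
      using c pos bc by (intro exp_mult_ge) auto
    also have "\<dots> \<le> exp (b * (ln y + d)) * (1 + b - b * c)"
    proof (rule mult_right_mono)
      show "0 \<le> 1 + b - b * c" using bc by linarith
    qed (use cy pos in auto)
    finally show ?thesis .
  qed
  then have "f powr (1 + b) * (1 + b) \<le> f powr (1 + b) * (exp (b * (ln y + d)) * (1 + b - b * c))"
    by (intro mult_left_mono) auto
  ultimately show ?thesis by (simp add: mult.commute)
qed

text \<open>This is \<open>exp (1 - w) \<le> 1 / w\<close> for \<open>w = h q / g\<^sup>2\<close>.\<close>

lemma comparison_le: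
  fixes q g h b :: real
  assumes "0 < q" "q \<le> 1" "0 < g" "0 < h" "0 < b"
  shows "comparison b q g h \<le> (g / h) powr b"
proof -
  define w where "w = h * q / g\<^sup>2"
  have w: "0 < w" using assms by (simp add: w_def)
  have lw: "ln w = ln h + ln q - 2 * ln g"
    using assms by (simp add: w_def ln_div ln_mult ln_realpow)
  have "1 - w \<le> - ln w" using ln_le_minus_one[OF w] by simp
  then have "b * (1 - w) \<le> b * (- ln w)" using assms by (intro mult_left_mono) auto
  then have "(1 + 2 * b) * ln q - b * ln g + b * (1 - w) \<le> (1 + b) * ln q + b * (ln g - ln h)"
    by (simp add: lw algebra_simps)
  also have "\<dots> \<le> b * (ln g - ln h)"
    using assms by (simp add: mult_nonneg_nonpos)
  finally show ?thesis
    using assms by (simp add: comparison_def w_def powr_def ln_div)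
qed

section \<open>Decreasing log-concave densities\<close>

text \<open>Monotonicity and concavity are required on the open half-line only: the rearrangement below is set to
  \<open>0\<close> at the origin.\<close>

locale decreasing_log_concave =
  fixes F :: "real \<Rightarrow> real"
  assumes integrable: "set_integrable lborel {0..} F"
    and nonneg: "0 \<le> F u"
    and antimono: "0 < a \<Longrightarrow> a \<le> b \<Longrightarrow> F b \<le> F a"
    and concave: "concave_on {u. 0 < u \<and> 0 < F u} (\<lambda>u. ln (F u))"
    and mass: "tail F 0 = 1"
begin

lemma four_points:
  assumes "0 < a" "a \<le> b" "0 \<le> w"
  shows "F a * F (b + w) \<le> F b * F (a + w)"
proof (cases "F (b + w) = 0 \<or> a = b + w")
  case True
  then show ?thesis using nonneg assms by auto
next
  case False
  define t where "t = (b - a) / (b + w - a)"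
  have l: "0 < b + w - a" using False assms by auto
  have t: "0 \<le> t" "t \<le> 1" using l assms by (auto simp: t_def)
  have pz: "0 < F (b + w)" using False nonneg[of "b + w"] by simp
  have p: "0 < F u" if "0 < u" "u \<le> b + w" for u
    using antimono[OF that] pz by simp
  have tl: "t * (b + w - a) = b - a" using l by (simp add: t_def)
  have e: "(1 - t) *\<^sub>R a + t *\<^sub>R (b + w) = b" "(1 - (1 - t)) *\<^sub>R a + (1 - t) *\<^sub>R (b + w) = a + w"
    using tl by (auto simp: algebra_simps)
  have m: "a \<in> {u. 0 < u \<and> 0 < F u}" "b + w \<in> {u. 0 < u \<and> 0 < F u}"
    using p assms by auto
  have "(1 - t) * ln (F a) + t * ln (F (b + w)) \<le> ln (F b)"
    using concave_onD[OF concave t m] unfolding e .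
  moreover have "(1 - (1 - t)) * ln (F a) + (1 - t) * ln (F (b + w)) \<le> ln (F (a + w))"
    using concave_onD[OF concave _ _ m, of "1 - t"] t unfolding e by simp
  ultimately have "ln (F a) + ln (F (b + w)) \<le> ln (F b) + ln (F (a + w))"
    by (simp add: algebra_simps)
  then have "ln (F a * F (b + w)) \<le> ln (F b * F (a + w))"
    using p[of a] p[of b] p[of "a + w"] pz assms by (simp add: ln_mult_pos)
  then show ?thesis using p[of a] p[of b] p[of "a + w"] pz assms by simp
qed

abbreviation "Q \<equiv> tail F"
abbreviation "G \<equiv> tail (tail F)"
abbreviation "H \<equiv> tail (tail (tail F))"

text \<open>Positivity of \<open>Q\<close> instead of \<open>F\<close> leaves out a possible last point of the support, which makes \<open>P\<close>
  open; \<open>F\<close> is continuous there, and all tails are differentiable.\<close>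

definition "P = {u. 0 < u \<and> 0 < Q u}"

lemmas Q_nonneg = tail_nonneg[OF integrable nonneg]

lemma F_hazard: "0 < a \<Longrightarrow> a \<le> b \<Longrightarrow> F a * Q b \<le> F b * Q a"
  by (rule tail_hazard_mono[OF integrable]) (auto intro: four_points)

lemma positive_in_P:
  assumes "x \<in> P"
  shows "0 < F x"
proof (rule ccontr)
  assume "\<not> 0 < F x"
  then have "F u \<le> 0 * F u" if "x \<le> u" for u
    using antimono[OF _ that] nonneg[of u] assms by (auto simp: P_def)
  then have "Q x \<le> tail (\<lambda>u. 0 * F u) x"
    using assms set_integrable_tail[OF integrable nonneg, of x]
    by (intro tail_mono) (auto simp: P_def set_integrable_def)
  then show False using assms by (simp only: tail_cmult) (simp add: P_def)
qed

lemma open_P: "open P"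
proof -
  have "open ({0<..} \<inter> Q -` {0<..})"
    by (intro continuous_open_preimage
        continuous_on_subset[OF continuous_on_tail[OF integrable nonneg]]) auto
  moreover have "{0<..} \<inter> Q -` {0<..} = P" by (auto simp: P_def)
  ultimately show ?thesis by simp
qed

lemma P_down: "x \<in> P \<Longrightarrow> 0 < y \<Longrightarrow> y \<le> x \<Longrightarrow> y \<in> P"
  using tail_antimono[OF integrable nonneg, of y x] by (auto simp: P_def)

lemma ex_P: "\<exists>z. z \<in> P"
proof (rule ccontr)
  assume "\<nexists>z. z \<in> P"
  then have z: "Q x = 0" if "0 < x" for x using that Q_nonneg[of x] by (force simp: P_def)
  have "((\<lambda>x. Q x) \<longlongrightarrow> Q 0) (at 0 within {0..})"
    using continuous_on_tail[OF integrable nonneg] by (simp add: continuous_on)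
  then have a: "((\<lambda>x. Q x) \<longlongrightarrow> Q 0) (at_right 0)"
    by (rule tendsto_within_subset) auto
  have b: "eventually (\<lambda>x. Q x = 0) (at_right 0)"
    using z by (auto simp: eventually_at_right_less eventually_at_filter)
  have "((\<lambda>x. 0) \<longlongrightarrow> Q 0) (at_right (0::real))"
    by (rule Lim_transform_eventually[OF a b])
  then have "Q 0 = 0"
    by (rule tendsto_unique[OF trivial_limit_at_right_real _ tendsto_const, rotated])
  then show False using mass by simp
qed

lemma G_integrable: "set_integrable lborel {0..} Q"
proof -
  obtain z where z: "z \<in> P" using ex_P by blast
  show ?thesis
    by (rule set_integrable_tail_tail[OF integrable nonneg F_hazard, where z = z])
      (use z positive_in_P in \<open>auto simp: P_def\<close>)
qed

lemmas G_nonneg = tail_nonneg[OF G_integrable Q_nonneg]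
lemmas Q_step = tail_ratio_step[OF integrable nonneg G_integrable F_hazard]

lemma H_integrable: "set_integrable lborel {0..} G"
proof -
  obtain z where z: "z \<in> P" using ex_P by blast
  show ?thesis
    by (rule set_integrable_tail_tail[OF G_integrable Q_nonneg Q_step(2), where z = z])
      (use z in \<open>auto simp: P_def\<close>)
qed

lemmas H_nonneg = tail_nonneg[OF H_integrable G_nonneg]
lemmas G_step = tail_ratio_step[OF G_integrable Q_nonneg H_integrable Q_step(2)]

lemma FG_le: "0 < x \<Longrightarrow> F x * G x \<le> (Q x)\<^sup>2"
  using Q_step(1)[of x x] by (simp add: power2_eq_square)

lemma HQ_le: "0 < x \<Longrightarrow> H x * Q x \<le> (G x)\<^sup>2"
  using G_step(1)[of x x] by (simp add: power2_eq_square mult.commute)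

lemma Q_square_le: "x \<in> P \<Longrightarrow> (Q x)\<^sup>2 \<le> 2 * F x * G x"
  using positive_in_P[of x] antimono[of x]
  by (intro tail_square_le[OF integrable nonneg G_integrable]) (auto simp: P_def)

lemma G_pos: "x \<in> P \<Longrightarrow> 0 < G x"
  using Q_square_le[of x] positive_in_P[of x] G_nonneg[of x]
  by (cases "G x = 0") (auto simp: P_def)

lemma continuous_on_F: "continuous_on P F"
proof -
  have sub: "P \<subseteq> {u. 0 < u \<and> 0 < F u}"
    using positive_in_P by (auto simp: P_def)
  have "convex P"
    using P_down by (auto simp: is_interval_convex_1[symmetric] is_interval_1 P_def
        intro: order.strict_trans2)
  then have "convex_on P (\<lambda>u. - ln (F u))"
    using convex_on_subset[OF _ sub] concave unfolding concave_on_def by blast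
  then have "continuous_on P (\<lambda>u. - ln (F u))"
    by (rule convex_on_continuous[OF open_P])
  then have "continuous_on P (\<lambda>u. exp (- (- ln (F u))))"
    by (rule continuous_on_exp[OF continuous_on_minus])
  then show ?thesis
    by (rule continuous_on_eq) (use positive_in_P in auto)
qed

lemma Q_deriv: "x \<in> P \<Longrightarrow> (Q has_real_derivative - F x) (at x)"
  by (rule tail_has_derivative[OF integrable nonneg open_P _ _ continuous_on_F]) (auto simp: P_def)

lemma G_deriv: "x \<in> P \<Longrightarrow> (G has_real_derivative - Q x) (at x)"
  by (rule tail_has_derivative[OF G_integrable Q_nonneg open_P])
    (auto simp: P_def intro: continuous_on_subset[OF continuous_on_tail[OF integrable nonneg]])

lemma H_deriv: "x \<in> P \<Longrightarrow> (H has_real_derivative - G x) (at x)"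
  by (rule tail_has_derivative[OF H_integrable G_nonneg open_P])
    (auto simp: P_def intro: continuous_on_subset[OF continuous_on_tail[OF G_integrable Q_nonneg]])

text \<open>The mean residual life \<open>G / Q\<close> has derivative \<open>F G / Q\<^sup>2 - 1\<close>, which is at least \<open>- 1/2\<close> because \<open>F\<close> is
  decreasing.\<close>

lemma mean_residual_decay:
  assumes "x \<in> P" "v \<in> P" "x \<le> v"
  shows "G x / Q x \<le> G v / Q v + (v - x) / 2"
proof -
  have "G x / Q x + x / 2 \<le> G v / Q v + v / 2"
  proof (rule DERIV_nonneg_imp_nondecreasing[OF assms(3)])
    fix u assume u: "x \<le> u" "u \<le> v"
    then have uP: "u \<in> P" using P_down[OF assms(2)] assms(1) by (auto simp: P_def)
    then have q: "0 < Q u" by (simp add: P_def)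
    have "((\<lambda>u. G u / Q u + u / 2) has_real_derivative
        ((- Q u) * Q u - G u * (- F u)) / (Q u * Q u) + 1 / 2) (at u)"
      by (rule DERIV_add[OF DERIV_divide[OF G_deriv[OF uP] Q_deriv[OF uP]]])
        (use q in \<open>auto intro!: derivative_eq_intros\<close>)
    moreover have "0 \<le> ((- Q u) * Q u - G u * (- F u)) / (Q u * Q u) + 1 / 2"
      using Q_square_le[OF uP] q by (simp add: field_simps power2_eq_square)
    ultimately show "\<exists>y. ((\<lambda>u. G u / Q u + u / 2) has_real_derivative y) (at u) \<and> 0 \<le> y"
      by blast
  qed
  then show ?thesis by (simp add: diff_divide_distrib)
qed

text \<open>Let \<open>m = G x / Q x\<close>. By the previous lemma, \<open>m Q v \<le> G v + (v - x) / 2 * Q v\<close> for every \<open>v \<ge> x\<close>. Integrating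
  over \<open>v\<close> gives \<open>m * G x \<le> H x + H x / 2\<close>, since \<open>H x\<close> is also the integral of \<open>(v - x) Q v\<close>.\<close>

lemma G_square_le:
  assumes x: "x \<in> P"
  shows "2 * (G x)\<^sup>2 \<le> 3 * H x * Q x"
proof -
  have x0: "0 \<le> x" and q: "0 < Q x" using x by (auto simp: P_def)
  define m where "m = G x / Q x"
  have m: "0 \<le> m" using G_nonneg q by (simp add: m_def)
  define c :: real where "c = 1 / 2"
  have c: "0 \<le> c" by (simp add: c_def)
  have [measurable]: "(\<lambda>u. ennreal (Q u) * indicator {x..} u) \<in> borel_measurable lborel"
    "(\<lambda>u. ennreal (G u) * indicator {x..} u) \<in> borel_measurable lborel"
    using measurable_ennreal_indicator[OF set_integrable_tail[OF G_integrable Q_nonneg x0]]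
      measurable_ennreal_indicator[OF set_integrable_tail[OF H_integrable G_nonneg x0]] .
  have "ennreal (m * G x) = ennreal m * (\<integral>\<^sup>+u\<in>{x..}. ennreal (Q u) \<partial>lborel)"
    using nn_integral_tail[OF G_integrable Q_nonneg x0] m G_nonneg by (simp add: ennreal_mult)
  also have "\<dots> = (\<integral>\<^sup>+u. ennreal m * (ennreal (Q u) * indicator {x..} u) \<partial>lborel)"
    by (simp add: nn_integral_cmult)
  also have "\<dots> \<le> (\<integral>\<^sup>+u. ennreal (G u) * indicator {x..} u
      + ennreal c * (ennreal ((u - x) ^ 1 * Q u) * indicator {x..} u) \<partial>lborel)"
  proof (rule nn_integral_mono)
    fix u :: real
    show "ennreal m * (ennreal (Q u) * indicator {x..} u) \<le> ennreal (G u) * indicator {x..} u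
      + ennreal c * (ennreal ((u - x) ^ 1 * Q u) * indicator {x..} u)"
    proof (cases "x \<le> u")
      case True
      have "m * Q u \<le> G u + c * ((u - x) * Q u)"
      proof (cases "u \<in> P")
        case uP: True
        then have qu: "0 < Q u" by (simp add: P_def)
        then show ?thesis
          using mult_right_mono[OF mean_residual_decay[OF x uP True], of "Q u"]
          by (simp add: m_def c_def distrib_right)
      next
        case False
        then show ?thesis using True x Q_nonneg[of u] G_nonneg[of u] by (auto simp: P_def not_less c_def)
      qed
      then show ?thesis
        using True m c Q_nonneg G_nonneg
        by (simp add: ennreal_mult[symmetric] ennreal_plus[symmetric] del: ennreal_plus)
    qed simp
  qed
  also have "\<dots> = ennreal (H x) + ennreal c * ennreal (H x)"
  proof -
    have "(\<integral>\<^sup>+u\<in>{x..}. ennreal ((u - x) ^ 1 * Q u) \<partial>lborel) = ennreal (H x)"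
      using nn_integral_tail_moment[OF G_integrable Q_nonneg x0, of 0]
        nn_integral_tail[OF H_integrable G_nonneg x0] by simp
    moreover have "(\<lambda>u. ennreal ((u - x) ^ 1 * Q u) * indicator {x..} u) \<in> borel_measurable lborel"
    proof -
      have "(\<lambda>u. (ennreal (u - x)) * (ennreal (Q u) * indicator {x..} u)) \<in> borel_measurable lborel"
        by measurable
      then show ?thesis
        by (rule measurable_cong[THEN iffD1, rotated])
          (use Q_nonneg in \<open>auto simp: indicator_def ennreal_mult\<close>)
    qed
    ultimately show ?thesis
      using nn_integral_tail[OF H_integrable G_nonneg x0]
      by (simp add: nn_integral_add nn_integral_cmult)
  qed
  also have "\<dots> = ennreal (H x + c * H x)"
    using H_nonneg[of x] c by (simp add: ennreal_mult[symmetric] ennreal_plus[symmetric] del: ennreal_plus)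
  finally have "m * G x \<le> H x + c * H x"
    using H_nonneg[of x] c by (simp add: ennreal_le_iff del: ennreal_plus)
  then show ?thesis using q unfolding c_def by (simp add: m_def field_simps power2_eq_square)
qed

lemma H_pos: "x \<in> P \<Longrightarrow> 0 < H x"
  using G_square_le[of x] G_pos[of x] H_nonneg[of x]
  by (cases "H x = 0") auto

lemma comparison_has_derivative:
  assumes x: "x \<in> P"
  shows "((\<lambda>u. comparison b (Q u) (G u) (H u)) has_real_derivative
    comparison b (Q x) (G x) (H x) * (- (1 + 2 * b) * F x / Q x + b * Q x / G x
      - b * (2 * H x * (Q x)\<^sup>2 / G x ^ 3 - Q x / G x - H x * F x / (G x)\<^sup>2))) (at x)"
proof -
  have q: "0 < Q x" "0 < G x" using x G_pos by (auto simp: P_def)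
  show ?thesis
    unfolding comparison_def
    using q
    by (auto intro!: derivative_eq_intros Q_deriv[OF x] G_deriv[OF x] H_deriv[OF x]
        simp: field_simps power2_eq_square power3_eq_cube)
qed

lemma power_le:
  assumes "0 < b" "0 < x"
  shows "indicator {x..} u * F u powr (1 + b) \<le> F x powr b * F u"
proof (cases "x \<le> u")
  case True
  have "indicator {x..} u * F u powr (1 + b) = F u powr b * F u"
    using True nonneg[of u] by (cases "F u = 0") (auto simp: powr_add)
  also have "\<dots> \<le> F x powr b * F u"
    using antimono[OF assms(2) True] nonneg[of u] assms by (intro mult_right_mono powr_mono2) auto
  finally show ?thesis .
qed (use nonneg[of u] in simp)

lemma set_integrable_power:
  assumes "0 < b" "0 < x"
  shows "set_integrable lborel {0..} (\<lambda>u. indicator {x..} u * F u powr (1 + b))"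
proof (rule set_integrable_bound)
  show "set_integrable lborel {0..} (\<lambda>u. F x powr b * F u)" using integrable by simp
  have [measurable]: "(\<lambda>u. indicator {0..} u *\<^sub>R F u) \<in> borel_measurable borel"
    using integrable unfolding set_integrable_def by simp
  have "(\<lambda>u. indicator {x..} u * (indicator {0..} u *\<^sub>R F u) powr (1 + b)) \<in> borel_measurable borel"
    by measurable
  also have "(\<lambda>u. indicator {x..} u * (indicator {0..} u *\<^sub>R F u) powr (1 + b))
    = (\<lambda>u. indicator {0..} u *\<^sub>R (indicator {x..} u * F u powr (1 + b)))"
    using assms by (auto simp: fun_eq_iff indicator_def)
  finally show "set_borel_measurable lborel {0..} (\<lambda>u. indicator {x..} u * F u powr (1 + b))"
    by (simp add: set_borel_measurable_def)
  show "AE u in lborel. u \<in> {0..} \<longrightarrow> norm (indicator {x..} u * F u powr (1 + b)) \<le> norm (F x powr b * F u)"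
    using power_le[OF assms] nonneg by (intro AE_I2) auto
qed

text \<open>The difference of the two sides increases along \<open>P\<close> by \<open>comparison_derivative_bound\<close>. Further out it is at
  most a constant times \<open>Q y\<close>, which can be made arbitrarily small within \<open>P\<close>. The power of \<open>F\<close> is cut off
  at \<open>x\<close>, beyond which \<open>F\<close> is bounded by \<open>F x\<close>.\<close>

lemma power_tail_bound:
  assumes b: "0 < b" and x: "x \<in> P"
  shows "(1 + b) * tail (\<lambda>u. indicator {x..} u * F u powr (1 + b)) x \<le> comparison b (Q x) (G x) (H x)"
proof -
  define \<psi> where "\<psi> u = indicator {x..} u * F u powr (1 + b)" for u
  have x0: "0 < x" using x by (simp add: P_def)
  have fx: "0 < F x" by (rule positive_in_P[OF x])
  have \<psi>0: "0 \<le> \<psi> u" for u by (simp add: \<psi>_def)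
  have le: "\<psi> u \<le> F x powr b * F u" for u
    using power_le[OF b x0] by (simp add: \<psi>_def)
  have \<psi>int: "set_integrable lborel {0..} \<psi>"
    using set_integrable_power[OF b x0] by (simp add: \<psi>_def[abs_def])
  define \<Phi> where "\<Phi> = tail \<psi>"
  have bound: "\<Phi> y \<le> F x powr b * Q y" if "x \<le> y" for y
  proof -
    have "\<Phi> y \<le> tail (\<lambda>u. F x powr b * F u) y"
      unfolding \<Phi>_def using set_integrable_tail[OF \<psi>int \<psi>0, of y] set_integrable_tail[OF integrable nonneg, of y] x0 that le
      by (intro tail_mono) auto
    then show ?thesis by (simp only: tail_cmult)
  qed
  have \<Phi>_deriv: "(\<Phi> has_real_derivative - (F u powr (1 + b))) (at u)" if u: "u \<in> P" "x < u" for u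
  proof -
    have "continuous_on (P \<inter> {x<..}) (\<lambda>u. F u powr (1 + b))"
      using positive_in_P by (intro continuous_on_powr' continuous_on_const
          continuous_on_subset[OF continuous_on_F]) (use b in \<open>auto intro: less_imp_le\<close>)
    then have "continuous_on (P \<inter> {x<..}) \<psi>"
      by (rule continuous_on_eq) (auto simp: \<psi>_def)
    then have "(tail \<psi> has_real_derivative - \<psi> u) (at u)"
      using u open_P by (intro tail_has_derivative[OF \<psi>int \<psi>0, of "P \<inter> {x<..}"]) (auto simp: P_def)
    then show ?thesis using u by (simp add: \<Phi>_def \<psi>_def)
  qed
  define D where "D u = (1 + b) * \<Phi> u - comparison b (Q u) (G u) (H u)" for u
  have D_le: "D x \<le> (1 + b) * (F x powr b * Q y)" if y: "y \<in> P" "x \<le> y" for y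
  proof -
    have uP: "u \<in> P" if "x \<le> u" "u \<le> y" for u using P_down[OF y(1)] that x0 by auto
    have "D x \<le> D y"
    proof (rule DERIV_nonneg_imp_increasing_open[OF y(2)])
      fix u assume u: "x < u" "u < y"
      then have P: "u \<in> P" using uP by auto
      then have q: "0 < Q u" "0 < u" by (auto simp: P_def)
      let ?c = "comparison b (Q u) (G u) (H u) * (- (1 + 2 * b) * F u / Q u + b * Q u / G u
        - b * (2 * H u * (Q u)\<^sup>2 / G u ^ 3 - Q u / G u - H u * F u / (G u)\<^sup>2))"
      have "(D has_real_derivative (1 + b) * - (F u powr (1 + b)) - ?c) (at u)"
        unfolding D_def
        by (rule DERIV_diff[OF DERIV_cmult[OF \<Phi>_deriv[OF P u(1)]] comparison_has_derivative[OF P]])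
      moreover have "?c \<le> - ((1 + b) * F u powr (1 + b))"
        using q b FG_le HQ_le Q_square_le[OF P] G_square_le[OF P] G_pos[OF P] positive_in_P[OF P]
        by (intro comparison_derivative_bound) auto
      ultimately show "\<exists>z. (D has_real_derivative z) (at u) \<and> 0 \<le> z"
        by (intro exI conjI) (assumption, simp)
    next
      have s: "{x..y} \<subseteq> {0..}" "{x..y} \<subseteq> P" using x0 uP by auto
      have \<Phi>: "continuous_on {x..y} \<Phi>"
        unfolding \<Phi>_def by (rule continuous_on_subset[OF continuous_on_tail[OF \<psi>int \<psi>0] s(1)])
      have cP: "continuous_on P (\<lambda>u. comparison b (Q u) (G u) (H u))"
        by (intro continuous_at_imp_continuous_on ballI DERIV_isCont[OF comparison_has_derivative])
      show "continuous_on {x..y} D"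
        unfolding D_def
        by (rule continuous_on_diff[OF continuous_on_mult_left[OF \<Phi>] continuous_on_subset[OF cP s(2)]])
    qed
    also have "\<dots> \<le> (1 + b) * \<Phi> y" by (simp add: D_def comparison_def)
    also have "\<dots> \<le> (1 + b) * (F x powr b * Q y)"
      using bound[OF y(2)] b by (intro mult_left_mono) auto
    finally show ?thesis .
  qed
  have "D x \<le> 0 + e" if e: "0 < e" for e
  proof -
    define k where "k = (1 + b) * F x powr b"
    have k: "0 < k" using b fx by (simp add: k_def)
    define r where "r = min (Q x) (e / k)"
    have r: "0 < r" "r \<le> Q x" "k * r \<le> e"
      using e k x by (auto simp: r_def P_def min_def field_simps)
    have "eventually (\<lambda>N. Q N < r) at_top"
      using order_tendstoD(2)[OF tail_tendsto_0[OF integrable nonneg] r(1)] .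
    then obtain N where N: "x \<le> N" "Q N < r"
      using eventually_happens'[OF _ eventually_conj[OF _ eventually_ge_at_top[of x]], of "\<lambda>N. Q N < r"] by auto
    \<comment> \<open>The point is chosen by the value of \<open>Q\<close>: this keeps it in \<open>P\<close> for bounded and unbounded support alike.\<close>
    have "\<exists>y\<ge>x. y \<le> N \<and> Q y = r"
      using N r x0 by (intro IVT2' continuous_on_subset[OF continuous_on_tail[OF integrable nonneg]]) auto
    then obtain y where y: "x \<le> y" "Q y = r" by blast
    then have "y \<in> P" using r x0 by (auto simp: P_def)
    from D_le[OF this y(1)] show ?thesis using r y by (simp add: k_def mult.assoc)
  qed
  then have "D x \<le> 0" by (rule field_le_epsilon)
  then show ?thesis by (simp add: D_def \<Phi>_def \<psi>_def[abs_def])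
qed

lemma GH_pos: "0 < G 0" "0 < H 0"
proof -
  obtain z where z: "z \<in> P" using ex_P by blast
  then show "0 < G 0" "0 < H 0"
    using G_pos[OF z] H_pos[OF z] tail_antimono[OF G_integrable Q_nonneg, of 0 z]
      tail_antimono[OF H_integrable G_nonneg, of 0 z] by (auto simp: P_def)
qed

text \<open>Only the bound at points of \<open>P\<close> is available, so \<open>x\<close> tends to \<open>0\<close> along a sequence.\<close>

lemma power_integral_bound:
  assumes b: "0 < b"
  shows "(\<integral>\<^sup>+u\<in>{0<..}. ennreal (F u powr (1 + b)) \<partial>lborel)
    \<le> ennreal ((G 0 / H 0) powr b / (1 + b))"
proof -
  obtain z where z: "z \<in> P" using ex_P by blast
  define s where "s n = z / Suc n" for n :: nat
  have z0: "0 < z" using z by (simp add: P_def)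
  have s: "s n \<in> P" "0 < s n" for n
    using z0 by (auto simp: s_def field_simps intro!: P_down[OF z])
  have s_lim: "s \<longlonglongrightarrow> 0"
    unfolding s_def using LIMSEQ_Suc[OF lim_const_over_n] by simp
  have s_dec: "s n \<le> s m" if "m \<le> n" for m n
    using that z0 unfolding s_def by (intro divide_left_mono) auto
  have [measurable]: "(\<lambda>u. indicator {0..} u *\<^sub>R F u) \<in> borel_measurable borel"
    using integrable unfolding set_integrable_def by simp
  define I where "I n u = ennreal (F u powr (1 + b)) * indicator {s n..} u" for n u
  have I_eq: "I n u = ennreal ((indicator {0..} u *\<^sub>R F u) powr (1 + b)) * indicator {s n..} u" for n u
    using s(2)[of n] by (auto simp: I_def indicator_def)
  have [measurable]: "I n \<in> borel_measurable lborel" for n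
    unfolding I_eq by measurable
  have I_inc: "incseq I"
  proof (intro incseq_SucI le_funI)
    fix n u
    show "I n u \<le> I (Suc n) u"
      using s_dec[of n "Suc n"] by (auto simp: I_def indicator_def)
  qed
  have "(\<Squnion>n. I n u) = ennreal (F u powr (1 + b)) * indicator {0<..} u" for u
  proof (cases "0 < u")
    case True
    have "\<exists>n. s n < u"
      using order_tendstoD(2)[OF s_lim True] by (auto simp: eventually_sequentially)
    then obtain n where "s n < u" by blast
    then have "I n u = ennreal (F u powr (1 + b))" by (simp add: I_def)
    moreover have "I m u \<le> ennreal (F u powr (1 + b))" for m by (simp add: I_def indicator_def)
    ultimately show ?thesis
      using True by (intro antisym SUP_least) (auto intro: SUP_upper2[of n])
  next
    case False
    then have "I n u = 0" for n using s(2)[of n] by (simp add: I_def)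
    then show ?thesis using False by simp
  qed
  then have "(\<integral>\<^sup>+u\<in>{0<..}. ennreal (F u powr (1 + b)) \<partial>lborel) = (\<integral>\<^sup>+u. (\<Squnion>n. I n u) \<partial>lborel)"
    by simp
  also have "\<dots> = (\<Squnion>n. \<integral>\<^sup>+u. I n u \<partial>lborel)"
    by (rule nn_integral_monotone_convergence_SUP[OF I_inc]) measurable
  also have "\<dots> \<le> ennreal ((G 0 / H 0) powr b / (1 + b))"
  proof (rule LIMSEQ_le)
    show "(\<lambda>n. \<integral>\<^sup>+u. I n u \<partial>lborel) \<longlonglongrightarrow> (\<Squnion>n. \<integral>\<^sup>+u. I n u \<partial>lborel)"
      using I_inc by (intro LIMSEQ_SUP) (auto simp: incseq_def le_fun_def intro!: nn_integral_mono)
    have at0: "(\<lambda>n. g (s n)) \<longlonglongrightarrow> g 0" if "continuous_on {0..} g" for g :: "real \<Rightarrow> real"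
      using that s_lim s(2)
      by (intro continuous_on_tendsto_compose[of "{0..}" g]) (auto intro!: always_eventually less_imp_le)
    show "(\<lambda>n. ennreal ((G (s n) / H (s n)) powr b / (1 + b))) \<longlonglongrightarrow> ennreal ((G 0 / H 0) powr b / (1 + b))"
      using GH_pos b
      by (intro tendsto_ennrealI tendsto_intros at0 continuous_on_tail[OF G_integrable Q_nonneg]
          continuous_on_tail[OF H_integrable G_nonneg]) auto
    have "(\<integral>\<^sup>+u. I n u \<partial>lborel) \<le> ennreal ((G (s n) / H (s n)) powr b / (1 + b))" for n
    proof -
      let ?p = "\<lambda>u. indicator {s n..} u * F u powr (1 + b)"
      have "(\<integral>\<^sup>+u. I n u \<partial>lborel) = (\<integral>\<^sup>+u\<in>{s n..}. ennreal (?p u) \<partial>lborel)"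
        by (intro nn_integral_cong) (auto simp: I_def indicator_def)
      also have "\<dots> = ennreal (tail ?p (s n))"
        using s(2)[of n] by (intro nn_integral_tail set_integrable_power[OF b s(2)]) auto
      also have "\<dots> \<le> ennreal ((G (s n) / H (s n)) powr b / (1 + b))"
      proof (rule ennreal_leI)
        have "Q (s n) \<le> 1"
          using tail_antimono[OF integrable nonneg, of 0 "s n"] s(2)[of n] mass by simp
        then have "comparison b (Q (s n)) (G (s n)) (H (s n)) \<le> (G (s n) / H (s n)) powr b"
          using s(1)[of n] G_pos H_pos b by (intro comparison_le) (auto simp: P_def)
        then have "(1 + b) * tail ?p (s n) \<le> (G (s n) / H (s n)) powr b"
          using power_tail_bound[OF b s(1)[of n]] by simp
        then show "tail ?p (s n) \<le> (G (s n) / H (s n)) powr b / (1 + b)"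
          using b by (simp add: field_simps)
      qed
      finally show ?thesis .
    qed
    then show "\<exists>N. \<forall>n\<ge>N. (\<integral>\<^sup>+u. I n u \<partial>lborel) \<le> ennreal ((G (s n) / H (s n)) powr b / (1 + b))"
      by blast
  qed
  finally show ?thesis .
qed

text \<open>The integral is \<open>2 H 0 - 2 t G 0 + t\<^sup>2\<close>, and the first two terms cancel for \<open>t = H 0 / G 0\<close>.\<close>

lemma second_moment_about:
  "(\<integral>\<^sup>+u\<in>{0..}. ennreal ((u - H 0 / G 0)\<^sup>2 * F u) \<partial>lborel) = ennreal ((H 0 / G 0)\<^sup>2)"
proof -
  define t where "t = H 0 / G 0"
  have gh: "0 < G 0" "0 < H 0" by (rule GH_pos)+
  have nnG: "(\<integral>\<^sup>+u\<in>{0..}. ennreal (u * F u) \<partial>lborel) = ennreal (G 0)"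
    using nn_integral_tail_moment[OF integrable nonneg order.refl, of 0]
      nn_integral_tail[OF G_integrable Q_nonneg order.refl] by simp
  have nnH: "(\<integral>\<^sup>+u\<in>{0..}. ennreal (u\<^sup>2 / 2 * F u) \<partial>lborel) = ennreal (H 0)"
    using nn_integral_tail_moment[OF integrable nonneg order.refl, of 1]
      nn_integral_tail_moment[OF G_integrable Q_nonneg order.refl, of 0]
      nn_integral_tail[OF H_integrable G_nonneg order.refl] by (simp add: power2_eq_square)
  have m: "(\<lambda>u. indicator {0..} u * F u) \<in> borel_measurable lborel"
    using integrable unfolding set_integrable_def by simp
  have *: "set_integrable lborel {0..} (\<lambda>u. p u * F u) \<and> tail (\<lambda>u. p u * F u) 0 = r"
    if nn: "(\<integral>\<^sup>+u\<in>{0..}. ennreal (p u * F u) \<partial>lborel) = ennreal r" and r: "0 \<le> r"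
      and p: "p \<in> borel_measurable borel" "\<And>u. 0 \<le> u \<Longrightarrow> 0 \<le> p u" for p r
  proof -
    have "has_bochner_integral lborel (\<lambda>u. indicator {0..} u *\<^sub>R (p u * F u)) r"
    proof (rule has_bochner_integral_nn_integral)
      have "(\<lambda>u. p u * (indicator {0..} u * F u)) \<in> borel_measurable lborel"
        using m p(1) by simp
      then show "(\<lambda>u. indicator {0..} u *\<^sub>R (p u * F u)) \<in> borel_measurable lborel"
        by (simp add: mult.left_commute)
      have "(\<integral>\<^sup>+u. ennreal (indicator {0..} u *\<^sub>R (p u * F u)) \<partial>lborel) = (\<integral>\<^sup>+u\<in>{0..}. ennreal (p u * F u) \<partial>lborel)"
        by (intro nn_integral_cong) (auto simp: indicator_def)
      then show "(\<integral>\<^sup>+u. ennreal (indicator {0..} u *\<^sub>R (p u * F u)) \<partial>lborel) = ennreal r"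
        using nn by simp
    qed (use r p(2) nonneg in \<open>auto simp: indicator_def\<close>)
    then show ?thesis
      by (auto simp: has_bochner_integral_iff set_integrable_def tail_def set_lebesgue_integral_def)
  qed
  have G: "set_integrable lborel {0..} (\<lambda>u. u * F u)" "tail (\<lambda>u. u * F u) 0 = G 0"
    using *[OF nnG] gh by auto
  have H: "set_integrable lborel {0..} (\<lambda>u. u\<^sup>2 / 2 * F u)" "tail (\<lambda>u. u\<^sup>2 / 2 * F u) 0 = H 0"
    using *[OF nnH] gh by auto
  have eq: "(u - t)\<^sup>2 * F u = 2 * (u\<^sup>2 / 2 * F u) - 2 * t * (u * F u) + t\<^sup>2 * F u" for u
    by (simp add: power2_eq_square algebra_simps)
  have iH: "set_integrable lborel {0..} (\<lambda>u. 2 * (u\<^sup>2 / 2 * F u))"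
    by (rule set_integrable_mult_right) (rule H(1))
  have iG: "set_integrable lborel {0..} (\<lambda>u. 2 * t * (u * F u))"
    by (rule set_integrable_mult_right) (rule G(1))
  have iF: "set_integrable lborel {0..} (\<lambda>u. t\<^sup>2 * F u)"
    by (rule set_integrable_mult_right) (rule integrable)
  note iD = set_integral_diff(1)[OF iH iG]
  have i: "set_integrable lborel {0..} (\<lambda>u. (u - t)\<^sup>2 * F u)"
    unfolding eq by (rule set_integral_add(1)[OF iD iF])
  have "tail (\<lambda>u. (u - t)\<^sup>2 * F u) 0
    = tail (\<lambda>u. 2 * (u\<^sup>2 / 2 * F u)) 0 - tail (\<lambda>u. 2 * t * (u * F u)) 0 + tail (\<lambda>u. t\<^sup>2 * F u) 0"
    unfolding eq tail_def set_integral_add(2)[OF iD iF] set_integral_diff(2)[OF iH iG] ..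
  also have "\<dots> = 2 * H 0 - 2 * t * G 0 + t\<^sup>2"
    unfolding tail_cmult G(2) H(2) mass by simp
  also have "\<dots> = t\<^sup>2"
    using gh by (simp add: t_def)
  finally have "tail (\<lambda>u. (u - t)\<^sup>2 * F u) 0 = t\<^sup>2" .
  then show ?thesis
    using nn_integral_tail[OF i, of 0] nonneg by (simp add: t_def)
qed

end

section \<open>Decreasing rearrangement of a log-concave density\<close>

lemma nn_integral_layer_cake:
  fixes g :: "real \<Rightarrow> real" and k :: "real \<Rightarrow> ennreal"
  assumes [measurable]: "g \<in> borel_measurable borel" "k \<in> borel_measurable borel"
    and nn: "\<And>x. 0 \<le> g x"
  shows "(\<integral>\<^sup>+x. k x * ennreal (g x) \<partial>lborel)
    = (\<integral>\<^sup>+l\<in>{0<..}. (\<integral>\<^sup>+x\<in>{x. l < g x}. k x \<partial>lborel) \<partial>lborel)"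
proof -
  have "(\<integral>\<^sup>+x. k x * ennreal (g x) \<partial>lborel)
    = (\<integral>\<^sup>+x. \<integral>\<^sup>+l. k x * indicator {(x, l). 0 < l \<and> l < g x} (x, l) \<partial>lborel \<partial>lborel)"
  proof (rule nn_integral_cong)
    fix x
    have "ennreal (g x) = emeasure lborel {0<..<g x}" using nn[of x] by simp
    also have "\<dots> = (\<integral>\<^sup>+l. indicator {0<..<g x} l \<partial>lborel)" by simp
    finally have "k x * ennreal (g x) = (\<integral>\<^sup>+l. k x * indicator {0<..<g x} l \<partial>lborel)"
      by (simp add: nn_integral_cmult)
    then show "k x * ennreal (g x)
      = (\<integral>\<^sup>+l. k x * indicator {(x, l). 0 < l \<and> l < g x} (x, l) \<partial>lborel)"
      by (simp add: indicator_def)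
  qed
  also have "\<dots> = (\<integral>\<^sup>+l. \<integral>\<^sup>+x. k x * indicator {(x, l). 0 < l \<and> l < g x} (x, l) \<partial>lborel \<partial>lborel)"
    by (rule lborel_pair.Fubini'[symmetric]) measurable
  also have "\<dots> = (\<integral>\<^sup>+l\<in>{0<..}. (\<integral>\<^sup>+x\<in>{x. l < g x}. k x \<partial>lborel) \<partial>lborel)"
  proof (rule nn_integral_cong)
    fix l :: real
    show "(\<integral>\<^sup>+x. k x * indicator {(x, l). 0 < l \<and> l < g x} (x, l) \<partial>lborel)
      = (\<integral>\<^sup>+x\<in>{x. l < g x}. k x \<partial>lborel) * indicator {0<..} l"
      by (cases "0 < l") (auto simp: indicator_def intro!: nn_integral_cong)
  qed
  finally show ?thesis .
qed

lemma nn_integral_powr_equimeasurable: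
  fixes f g :: "real \<Rightarrow> real"
  assumes [measurable]: "f \<in> borel_measurable borel" "g \<in> borel_measurable borel"
    and nn: "\<And>x. 0 \<le> f x" "\<And>x. 0 \<le> g x" and a: "0 < a"
    and eq: "\<And>l. 0 < l \<Longrightarrow> emeasure lborel {x. l < f x} = emeasure lborel {x. l < g x}"
  shows "(\<integral>\<^sup>+x. ennreal (f x powr a) \<partial>lborel) = (\<integral>\<^sup>+x. ennreal (g x powr a) \<partial>lborel)"
proof -
  have *: "{x. l < h x powr a} = {x. l powr (1 / a) < h x}"
    if "0 < l" "\<And>x. 0 \<le> h x" for l and h :: "real \<Rightarrow> real"
  proof -
    have "l < h x powr a \<longleftrightarrow> l powr (1 / a) < h x" for x
    proof -
      have "l < h x powr a \<longleftrightarrow> (l powr (1 / a)) powr a < h x powr a"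
        using that a by (simp add: powr_powr)
      also have "\<dots> \<longleftrightarrow> l powr (1 / a) < h x"
      proof
        assume lt: "(l powr (1 / a)) powr a < h x powr a"
        show "l powr (1 / a) < h x"
        proof (rule ccontr)
          assume "\<not> l powr (1 / a) < h x"
          then have "h x powr a \<le> (l powr (1 / a)) powr a"
            using that(2) a by (intro powr_mono2) auto
          with lt show False by linarith
        qed
      next
        assume "l powr (1 / a) < h x"
        then show "(l powr (1 / a)) powr a < h x powr a"
          using a by (intro powr_less_mono2) auto
      qed
      finally show ?thesis .
    qed
    then show ?thesis by simp
  qed
  have layer: "(\<integral>\<^sup>+x. ennreal (h x powr a) \<partial>lborel)
      = (\<integral>\<^sup>+l. emeasure lborel {x. l powr (1 / a) < h x} * indicator {0<..} l \<partial>lborel)"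
    if [measurable]: "h \<in> borel_measurable borel" and "\<And>x. 0 \<le> h x" for h :: "real \<Rightarrow> real"
  proof -
    have "(\<integral>\<^sup>+x. 1 * ennreal (h x powr a) \<partial>lborel)
      = (\<integral>\<^sup>+l\<in>{0<..}. (\<integral>\<^sup>+x\<in>{x. l < h x powr a}. 1 \<partial>lborel) \<partial>lborel)"
      by (rule nn_integral_layer_cake) auto
    also have "\<dots> = (\<integral>\<^sup>+l. emeasure lborel {x. l powr (1 / a) < h x} * indicator {0<..} l \<partial>lborel)"
      by (intro nn_integral_cong) (auto simp: indicator_def[of "{0<..}"] *[OF _ that(2)])
    finally show ?thesis by simp
  qed
  have "(\<integral>\<^sup>+l. emeasure lborel {x. l powr (1 / a) < f x} * indicator {0<..} l \<partial>lborel)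
      = (\<integral>\<^sup>+l. emeasure lborel {x. l powr (1 / a) < g x} * indicator {0<..} l \<partial>lborel)"
    using eq by (intro nn_integral_cong) (auto simp: indicator_def)
  then show ?thesis using layer nn by simp
qed

lemma nn_integral_square_interval:
  fixes p q c :: real
  assumes "p \<le> q"
  shows "(\<integral>\<^sup>+x\<in>{p..q}. ennreal ((x - c)\<^sup>2) \<partial>lborel) = ennreal (((q - c) ^ 3 - (p - c) ^ 3) / 3)"
proof -
  have "(\<integral>\<^sup>+x. ennreal ((x - c)\<^sup>2) * indicator {p..q} x \<partial>lborel)
     = ennreal ((q - c) ^ 3 / 3 - (p - c) ^ 3 / 3)"
    using assms by (intro nn_integral_FTC_Icc) (auto intro!: derivative_eq_intros)
  then show ?thesis by (simp add: diff_divide_distrib)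
qed

text \<open>Up to the factor \<open>3\<close>, the two sides are the second moments of \<open>[p, q]\<close> about \<open>c\<close> and of \<open>[0, q - p]\<close> about
  \<open>t\<close>. The hypotheses say that \<open>c\<close> is no farther from the midpoint of its interval than \<open>t\<close> is from the midpoint of
  the other.\<close>

lemma cube_sum_le_between:
  fixes p q c t :: real
  assumes "p \<le> q" "min (p + t) (q - t) \<le> c" "c \<le> max (p + t) (q - t)"
  shows "(q - c) ^ 3 - (p - c) ^ 3 \<le> (q - p - t) ^ 3 - (0 - t) ^ 3"
proof -
  have "0 \<le> (c - p - t) * (q - t - c)"
    using assms by (auto simp: zero_le_mult_iff min_def max_def split: if_splits)
  then have "0 \<le> 3 * (q - p) * ((c - p - t) * (q - t - c))"
    using assms(1) by simp
  also have "\<dots> = ((q - p - t) ^ 3 - (0 - t) ^ 3) - ((q - c) ^ 3 - (p - c) ^ 3)"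
    by (simp add: power3_eq_cube algebra_simps)
  finally show ?thesis by simp
qed

locale log_concave_density =
  fixes f :: "real \<Rightarrow> real"
  assumes measurable_f[measurable]: "f \<in> borel_measurable borel"
    and f_nonneg: "0 \<le> f x"
    and f_mass: "(\<integral>\<^sup>+x. ennreal (f x) \<partial>lborel) = 1"
    and f_log_concave: "0 < f x \<Longrightarrow> 0 < f y \<Longrightarrow> 0 < u \<Longrightarrow> 0 < v \<Longrightarrow> u + v = 1
      \<Longrightarrow> exp (u * ln (f x) + v * ln (f y)) \<le> f (u * x + v * y)"
begin

definition level :: "real \<Rightarrow> real set" where
  "level l = {x. l < f x}"

definition len :: "real \<Rightarrow> real" where
  "len l = measure lborel (level l)"

definition lo :: "real \<Rightarrow> real" where "lo l = Inf (level l)"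
definition hi :: "real \<Rightarrow> real" where "hi l = Sup (level l)"

lemma level_sets[measurable]: "level l \<in> sets borel"
  unfolding level_def by measurable

lemma level_mono: "l \<le> l' \<Longrightarrow> level l' \<subseteq> level l"
  by (auto simp: level_def)

lemma level_markov:
  assumes "0 < l"
  shows "ennreal l * emeasure lborel (level l) \<le> 1"
proof -
  have "ennreal l * emeasure lborel (level l) = (\<integral>\<^sup>+x. ennreal l * indicator (level l) x \<partial>lborel)"
    by (simp add: nn_integral_cmult)
  also have "\<dots> \<le> (\<integral>\<^sup>+x. ennreal (f x) \<partial>lborel)"
    by (intro nn_integral_mono) (auto simp: level_def indicator_def intro!: ennreal_leI)
  finally show ?thesis by (simp add: f_mass)
qed

lemma emeasure_level: "0 < l \<Longrightarrow> emeasure lborel (level l) = ennreal (len l)"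
  using level_markov[of l] unfolding len_def
  by (intro emeasure_eq_ennreal_measure) (auto simp: ennreal_mult_top top_unique)

lemma len_nonneg: "0 \<le> len l" by (simp add: len_def)

lemma len_markov:
  assumes "0 < l"
  shows "l * len l \<le> 1"
  using level_markov[OF assms] assms len_nonneg[of l]
  by (simp add: emeasure_level ennreal_mult[symmetric] ennreal_le_iff[of 1, simplified])

lemma len_antimono: "0 < l \<Longrightarrow> l \<le> l' \<Longrightarrow> len l' \<le> len l"
  using emeasure_mono[OF level_mono[of l l'], of lborel] len_nonneg[of l]
  by (simp add: emeasure_level)

lemma level_combine:
  assumes "x \<in> level l" "y \<in> level l'" "0 < l" "0 < l'" "0 < u" "0 < v" "u + v = 1"
  shows "u * x + v * y \<in> level (exp (u * ln l + v * ln l'))"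
proof -
  have "u * ln l + v * ln l' < u * ln (f x) + v * ln (f y)"
    using assms by (intro add_strict_mono mult_strict_left_mono) (auto simp: level_def)
  then have "exp (u * ln l + v * ln l') < exp (u * ln (f x) + v * ln (f y))" by simp
  also have "\<dots> \<le> f (u * x + v * y)"
    using assms by (intro f_log_concave) (auto simp: level_def)
  finally show ?thesis by (simp add: level_def)
qed

lemma level_interval:
  assumes "0 < l" "x \<in> level l" "y \<in> level l" "x \<le> z" "z \<le> y"
  shows "z \<in> level l"
proof (cases "z = x \<or> z = y")
  case False
  define v where "v = (z - x) / (y - x)"
  have xy: "0 < y - x" "0 < z - x" "z - x < y - x" using False assms by auto
  then have v: "0 < v" "0 < 1 - v" by (auto simp: v_def)
  have "v * (y - x) = z - x" using xy by (simp add: v_def)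
  then have z: "(1 - v) * x + v * y = z" by (simp add: algebra_simps)
  have "exp ((1 - v) * ln l + v * ln l) = l" using assms(1) by (simp add: algebra_simps)
  then show ?thesis
    using level_combine[OF assms(2,3,1,1) v(2,1)] z by simp
qed (use assms in auto)

lemma level_diameter:
  assumes "0 < l" "x \<in> level l" "y \<in> level l"
  shows "y - x \<le> len l"
proof (cases "x \<le> y")
  case True
  then have "emeasure lborel {x..y} \<le> emeasure lborel (level l)"
    using level_interval[OF assms] by (intro emeasure_mono) auto
  then show ?thesis using True assms(1) len_nonneg by (simp add: emeasure_level)
qed (use len_nonneg[of l] in auto)

lemma level_bdd:
  assumes "0 < l"
  shows "bdd_above (level l)" "bdd_below (level l)"
proof -
  show "bdd_above (level l)"
  proof (cases "level l = {}")
    case False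
    then obtain x where "x \<in> level l" by blast
    then show ?thesis using level_diameter[OF assms] by (intro bdd_aboveI[of _ "x + len l"]) force
  qed simp
  show "bdd_below (level l)"
  proof (cases "level l = {}")
    case False
    then obtain x where "x \<in> level l" by blast
    then show ?thesis using level_diameter[OF assms] by (intro bdd_belowI[of _ "x - len l"]) force
  qed simp
qed

lemma level_bounds:
  assumes "0 < l" "x \<in> level l"
  shows "lo l \<le> x" "x \<le> hi l"
  unfolding lo_def hi_def using level_bdd[OF assms(1)] assms(2)
  by (auto intro: cInf_lower cSup_upper)

lemma interior_level:
  assumes "0 < l" "level l \<noteq> {}"
  shows "{lo l<..<hi l} \<subseteq> level l"
proof
  fix z assume z: "z \<in> {lo l<..<hi l}"
  obtain x where x: "x \<in> level l" "x < z"
    using z cInf_less_iff[OF assms(2) level_bdd(2)[OF assms(1)]] by (auto simp: lo_def)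
  obtain y where y: "y \<in> level l" "z < y"
    using z less_cSup_iff[OF assms(2) level_bdd(1)[OF assms(1)]] by (auto simp: hi_def)
  show "z \<in> level l"
    by (rule level_interval[OF assms(1) x(1) y(1)]) (use x y in auto)
qed

lemma len_eq:
  assumes "0 < l" "level l \<noteq> {}"
  shows "lo l \<le> hi l" "len l = hi l - lo l"
proof -
  show le: "lo l \<le> hi l" using level_bounds[OF assms(1)] assms(2) by fastforce
  have "emeasure lborel {lo l<..<hi l} \<le> emeasure lborel (level l)"
    using interior_level[OF assms] by (intro emeasure_mono) auto
  moreover have "emeasure lborel (level l) \<le> emeasure lborel {lo l..hi l}"
    using level_bounds[OF assms(1)] by (intro emeasure_mono) auto
  ultimately show "len l = hi l - lo l"
    using le assms(1) len_nonneg[of l] by (simp add: emeasure_level)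
qed

text \<open>The weighted sum of two levels is contained in the level at the weighted geometric mean of the heights,
  so its end points are at least as far out.\<close>

lemma len_concave:
  assumes l: "0 < l" "level l \<noteq> {}" "0 < l'" "level l' \<noteq> {}"
    and uv: "0 < u" "0 < v" "u + v = 1"
  shows "u * len l + v * len l' \<le> len (exp (u * ln l + v * ln l'))"
proof -
  define m where "m = exp (u * ln l + v * ln l')"
  have m: "0 < m" by (simp add: m_def)
  have mem: "u * x + v * y \<in> level m" if "x \<in> level l" "y \<in> level l'" for x y
    unfolding m_def by (rule level_combine[OF that l(1,3) uv])
  have ne: "level m \<noteq> {}" using mem l by blast
  have "u * hi l + v * y \<le> hi m" if "y \<in> level l'" for y
  proof -
    have "hi l \<le> (hi m - v * y) / u"
      unfolding hi_def[of l] using level_bounds(2)[OF m mem[OF _ that]] uv l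
      by (intro cSup_least) (auto simp: field_simps)
    then show ?thesis using uv by (simp add: field_simps)
  qed
  then have "hi l' \<le> (hi m - u * hi l) / v"
    unfolding hi_def[of l'] using uv l
    by (intro cSup_least) (auto simp: field_simps)
  then have hi: "u * hi l + v * hi l' \<le> hi m" using uv by (simp add: field_simps)
  have "lo m \<le> u * lo l + v * y" if "y \<in> level l'" for y
  proof -
    have "(lo m - v * y) / u \<le> lo l"
      unfolding lo_def[of l] using level_bounds(1)[OF m mem[OF _ that]] uv l
      by (intro cInf_greatest) (auto simp: field_simps)
    then show ?thesis using uv by (simp add: field_simps)
  qed
  then have "(lo m - u * lo l) / v \<le> lo l'"
    unfolding lo_def[of l'] using uv l
    by (intro cInf_greatest) (auto simp: field_simps)
  then have "lo m \<le> u * lo l + v * lo l'" using uv by (simp add: field_simps)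
  then have "u * (hi l - lo l) + v * (hi l' - lo l') \<le> hi m - lo m"
    using hi by (simp add: right_diff_distrib)
  then show ?thesis
    by (simp only: m_def[symmetric] len_eq(2)[OF l(1,2)] len_eq(2)[OF l(3,4)] len_eq(2)[OF m ne])
qed

text \<open>The decreasing rearrangement. The inserted \<open>0\<close> is its value beyond the support.\<close>

definition rearr :: "real \<Rightarrow> real" where
  "rearr x = (if 0 < x then Sup (insert 0 {l. 0 < l \<and> x < len l}) else 0)"

lemma rearr_bdd: "0 < x \<Longrightarrow> bdd_above (insert 0 {l. 0 < l \<and> x < len l})"
proof (rule bdd_aboveI[of _ "1 / x"])
  fix l assume x: "0 < x" and "l \<in> insert 0 {l. 0 < l \<and> x < len l}"
  then show "l \<le> 1 / x"
  proof (cases "l = 0")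
    case False
    then have l: "0 < l" "x < len l" using \<open>l \<in> _\<close> by auto
    then have "l * x \<le> l * len l" by simp
    also have "\<dots> \<le> 1" using len_markov[OF l(1)] .
    finally show ?thesis using x by (simp add: field_simps)
  qed simp
qed

lemma rearr_nonneg: "0 \<le> rearr x"
  unfolding rearr_def using rearr_bdd[of x] by (auto intro: cSup_upper)

text \<open>A superlevel set is the increasing union of the superlevel sets at larger heights.\<close>

lemma len_right_continuous:
  assumes "0 < l" "x < len l" "0 \<le> x"
  shows "\<exists>l'>l. x < len l'"
proof -
  define s where "s n = l + 1 / real (Suc n)" for n
  have s: "l < s n" for n by (simp add: s_def)
  have "incseq (\<lambda>n. level (s n))"
    by (intro incseq_SucI level_mono) (simp add: s_def field_simps)
  then have "(\<Squnion>n. emeasure lborel (level (s n))) = emeasure lborel (\<Union>n. level (s n))"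
    by (intro SUP_emeasure_incseq) auto
  also have "(\<Union>n. level (s n)) = level l"
  proof (intro equalityI subsetI)
    fix y assume "y \<in> level l"
    then have "0 < f y - l" by (simp add: level_def)
    then obtain n where "inverse (real (Suc n)) < f y - l" using reals_Archimedean by blast
    then show "y \<in> (\<Union>n. level (s n))" by (auto simp: level_def s_def inverse_eq_divide intro!: exI[of _ n])
  qed (use level_mono s in \<open>auto intro: less_imp_le\<close>)
  finally have "ennreal x < (\<Squnion>n. emeasure lborel (level (s n)))"
    using assms by (simp add: emeasure_level ennreal_less_iff)
  then obtain n where "ennreal x < emeasure lborel (level (s n))"
    by (auto simp: less_SUP_iff)
  moreover have "0 < s n" using s[of n] assms(1) by simp
  ultimately have "x < len (s n)"
    using assms(3) by (simp add: emeasure_level ennreal_less_iff)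
  then show ?thesis using s by blast
qed

lemma less_rearr_iff:
  assumes "0 < l"
  shows "l < rearr x \<longleftrightarrow> 0 < x \<and> x < len l"
proof (cases "0 < x")
  case True
  have "l < rearr x \<longleftrightarrow> (\<exists>l'\<in>insert 0 {l. 0 < l \<and> x < len l}. l < l')"
    unfolding rearr_def using True less_cSup_iff[OF _ rearr_bdd[OF True]] by simp
  also have "\<dots> \<longleftrightarrow> (\<exists>l'>l. x < len l')"
    using assms by (auto intro: less_trans)
  also have "\<dots> \<longleftrightarrow> x < len l"
    using len_right_continuous[OF assms, of x] len_antimono[OF assms] True
    by (meson less_eq_real_def less_le_trans)
  finally show ?thesis using True by simp
qed (use assms in \<open>simp add: rearr_def\<close>)

lemma rearr_level: "0 < l \<Longrightarrow> {x. l < rearr x} = {0<..<len l}"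
  by (auto simp: less_rearr_iff)

lemma measurable_rearr[measurable]: "rearr \<in> borel_measurable borel"
proof (rule borel_measurable_iff_greater[THEN iffD2], rule allI)
  fix a :: real
  consider "a < 0" | "a = 0" | "0 < a" by linarith
  then show "{w \<in> space borel. a < rearr w} \<in> sets borel"
  proof cases
    case 1
    then have "{w \<in> space borel. a < rearr w} = UNIV"
      using rearr_nonneg by (auto intro: less_le_trans)
    then show ?thesis by simp
  next
    case 2
    have "{w \<in> space borel. a < rearr w} = (\<Union>n. {w. 1 / real (Suc n) < rearr w})"
    proof (intro equalityI subsetI)
      fix w assume "w \<in> {w \<in> space borel. a < rearr w}"
      then have "0 < rearr w" using 2 by simp
      then obtain n where "inverse (real (Suc n)) < rearr w" using reals_Archimedean by blast
      then show "w \<in> (\<Union>n. {w. 1 / real (Suc n) < rearr w})"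
        by (auto simp: inverse_eq_divide)
    next
      fix w assume "w \<in> (\<Union>n. {w. 1 / real (Suc n) < rearr w})"
      then obtain n where "1 / real (Suc n) < rearr w" by blast
      moreover have "0 < 1 / real (Suc n)" by simp
      ultimately have "0 < rearr w" by (rule less_trans[rotated])
      then show "w \<in> {w \<in> space borel. a < rearr w}" using 2 by simp
    qed
    also have "\<dots> \<in> sets borel"
      by (intro sets.countable_UN) (auto simp: rearr_level simp del: of_nat_Suc)
    finally show ?thesis .
  next
    case 3
    then show ?thesis by (simp add: rearr_level)
  qed
qed

lemma rearr_powr:
  assumes "0 < a"
  shows "(\<integral>\<^sup>+x. ennreal (rearr x powr a) \<partial>lborel) = (\<integral>\<^sup>+x. ennreal (f x powr a) \<partial>lborel)"
proof (rule nn_integral_powr_equimeasurable[OF _ _ rearr_nonneg f_nonneg assms])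
  fix l :: real assume l: "0 < l"
  show "emeasure lborel {x. l < rearr x} = emeasure lborel {x. l < f x}"
    using emeasure_level[OF l] len_nonneg[of l] by (simp add: rearr_level[OF l] level_def)
qed measurable

lemma rearr_antimono:
  assumes "0 < a" "a \<le> b"
  shows "rearr b \<le> rearr a"
  unfolding rearr_def using assms rearr_bdd[OF assms(1)]
  by (auto intro!: cSup_subset_mono)

text \<open>Heights below \<open>rearr x\<close> and \<open>rearr y\<close> belong to levels longer than \<open>x\<close> and \<open>y\<close>, so \<open>len_concave\<close> bounds the
  length of the combined level; the heights then tend to \<open>rearr x\<close> and \<open>rearr y\<close>.\<close>

lemma rearr_concave: "concave_on {u. 0 < u \<and> 0 < rearr u} (\<lambda>u. ln (rearr u))"
  unfolding concave_on_iff
proof (intro conjI ballI allI impI)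
  show "convex {u. 0 < u \<and> 0 < rearr u}"
    unfolding is_interval_convex_1[symmetric] is_interval_1
    using rearr_antimono by (force intro: less_le_trans)
  fix x y u v :: real
  assume x: "x \<in> {u. 0 < u \<and> 0 < rearr u}" and y: "y \<in> {u. 0 < u \<and> 0 < rearr u}"
    and uv: "0 \<le> u" "0 \<le> v" "u + v = 1"
  show "u * ln (rearr x) + v * ln (rearr y) \<le> ln (rearr (u *\<^sub>R x + v *\<^sub>R y))"
  proof (cases "u = 0 \<or> v = 0")
    case True
    then show ?thesis using uv by auto
  next
    case False
    then have p: "0 < u" "0 < v" using uv by auto
    define r where "r = ln (rearr (u * x + v * y))"
    have step: "u * s + v * s' \<le> r" if s: "s < ln (rearr x)" "s' < ln (rearr y)" for s s'
    proof -
      have e: "exp s < rearr x" "exp s' < rearr y"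
        using s x y exp_less_mono[OF s(1)] exp_less_mono[OF s(2)] by auto
      then have c: "x < len (exp s)" "y < len (exp s')"
        by (auto simp: less_rearr_iff)
      then have ne: "level (exp s) \<noteq> {}" "level (exp s') \<noteq> {}"
        using x y by (auto simp: len_def)
      have "u * x + v * y < u * len (exp s) + v * len (exp s')"
        using c p by (intro add_strict_mono mult_strict_left_mono)
      also have "\<dots> \<le> len (exp (u * s + v * s'))"
        using len_concave[OF _ ne(1) _ ne(2) p uv(3)] by simp
      finally have "exp (u * s + v * s') < rearr (u * x + v * y)"
        using x y p by (simp add: less_rearr_iff add_pos_pos)
      then have "ln (exp (u * s + v * s')) < r"
        unfolding r_def by (subst ln_less_cancel_iff) (auto intro: less_trans[OF exp_gt_zero])
      then show ?thesis by simp
    qed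
    have step': "u * ln (rearr x) + v * s' \<le> r" if s': "s' < ln (rearr y)" for s'
    proof -
      have "ln (rearr x) \<le> (r - v * s') / u"
        by (rule dense_le) (use step[OF _ s'] p in \<open>simp add: field_simps\<close>)
      then show ?thesis using p by (simp add: field_simps)
    qed
    have "ln (rearr y) \<le> (r - u * ln (rearr x)) / v"
    proof (rule dense_le)
      fix s' assume "s' < ln (rearr y)"
      from step'[OF this] show "s' \<le> (r - u * ln (rearr x)) / v"
        using p by (simp add: field_simps)
    qed
    then show ?thesis using p by (simp add: field_simps r_def)
  qed
qed

lemma rearr_decreasing_log_concave: "decreasing_log_concave rearr"
proof
  have eq: "indicator {0..} u * rearr u = rearr u" for u
    by (simp add: indicator_def rearr_def)
  have "(\<integral>\<^sup>+x. ennreal (rearr x) \<partial>lborel) = ennreal 1"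
    using rearr_powr[of 1] f_mass rearr_nonneg f_nonneg by simp
  then have "has_bochner_integral lborel rearr 1"
    using rearr_nonneg by (intro has_bochner_integral_nn_integral) auto
  then show "set_integrable lborel {0..} rearr" "tail rearr 0 = 1"
    by (auto simp: set_integrable_def tail_def set_lebesgue_integral_def eq has_bochner_integral_iff)
qed (auto simp: rearr_nonneg rearr_antimono rearr_concave)

text \<open>For one level, the admissible \<open>c\<close> form the interval between \<open>lo l + t\<close> and \<open>hi l - t\<close>. Because the levels are
  nested, any two of these intervals meet, and therefore all of them have a point in common.\<close>

lemma ex_center:
  "\<exists>c. \<forall>l>0. level l \<noteq> {} \<longrightarrow> min (lo l + t) (hi l - t) \<le> c \<and> c \<le> max (lo l + t) (hi l - t)"
proof -
  define L where "L = {l. 0 < l \<and> level l \<noteq> {}}"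
  have cross: "min (lo l + t) (hi l - t) \<le> max (lo l' + t) (hi l' - t)"
    if "l \<in> L" "l' \<in> L" for l l'
  proof -
    have l: "0 < l" "level l \<noteq> {}" "0 < l'" "level l' \<noteq> {}" using that by (auto simp: L_def)
    show ?thesis
    proof (cases "l \<le> l'")
      case True
      have "lo l \<le> lo l'"
        unfolding lo_def by (rule cInf_superset_mono[OF l(4) level_bdd(2)[OF l(1)] level_mono[OF True]])
      then show ?thesis by linarith
    next
      case False
      then have "hi l \<le> hi l'"
        unfolding hi_def by (intro cSup_subset_mono[OF l(2) level_bdd(1)[OF l(3)] level_mono]) simp
      then show ?thesis by linarith
    qed
  qed
  show ?thesis
  proof (cases "L = {}")
    case False
    then obtain l0 where "l0 \<in> L" by blast
    let ?c = "SUP l\<in>L. min (lo l + t) (hi l - t)"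
    have "bdd_above ((\<lambda>l. min (lo l + t) (hi l - t)) ` L)"
      using cross[OF _ \<open>l0 \<in> L\<close>] by (intro bdd_aboveI2) auto
    then have "min (lo l + t) (hi l - t) \<le> ?c \<and> ?c \<le> max (lo l + t) (hi l - t)" if "l \<in> L" for l
      using that cross[OF _ that] False by (intro conjI cSUP_upper cSUP_least) auto
    then show ?thesis by (auto simp: L_def)
  qed (auto simp: L_def)
qed

text \<open>The comparison holds level by level, by \<open>cube_sum_le_between\<close>, with one centre \<open>c\<close> for all levels.\<close>

lemma second_moment_le_rearr:
  "\<exists>c. (\<integral>\<^sup>+x. ennreal ((x - c)\<^sup>2) * ennreal (f x) \<partial>lborel)
     \<le> (\<integral>\<^sup>+x. ennreal ((x - t)\<^sup>2) * ennreal (rearr x) \<partial>lborel)"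
proof -
  obtain c where c: "\<And>l. 0 < l \<Longrightarrow> level l \<noteq> {} \<Longrightarrow>
      min (lo l + t) (hi l - t) \<le> c \<and> c \<le> max (lo l + t) (hi l - t)"
    using ex_center by blast
  have "(\<integral>\<^sup>+x. ennreal ((x - c)\<^sup>2) * ennreal (f x) \<partial>lborel)
    = (\<integral>\<^sup>+l\<in>{0<..}. (\<integral>\<^sup>+x\<in>{x. l < f x}. ennreal ((x - c)\<^sup>2) \<partial>lborel) \<partial>lborel)"
    by (rule nn_integral_layer_cake) (auto simp: f_nonneg)
  also have "\<dots> \<le> (\<integral>\<^sup>+l\<in>{0<..}. (\<integral>\<^sup>+x\<in>{x. l < rearr x}. ennreal ((x - t)\<^sup>2) \<partial>lborel) \<partial>lborel)"
  proof (rule nn_integral_mono)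
    fix l :: real
    have "(\<integral>\<^sup>+x\<in>level l. ennreal ((x - c)\<^sup>2) \<partial>lborel) \<le> (\<integral>\<^sup>+x\<in>{x. l < rearr x}. ennreal ((x - t)\<^sup>2) \<partial>lborel)"
      if l: "0 < l"
    proof (cases "level l = {}")
      case False
      note lh = len_eq[OF l False]
      have "(\<integral>\<^sup>+x\<in>level l. ennreal ((x - c)\<^sup>2) \<partial>lborel) \<le> (\<integral>\<^sup>+x\<in>{lo l..hi l}. ennreal ((x - c)\<^sup>2) \<partial>lborel)"
        using level_bounds[OF l] by (intro nn_integral_mono) (auto simp: indicator_def)
      also have "\<dots> \<le> (\<integral>\<^sup>+x\<in>{0..len l}. ennreal ((x - t)\<^sup>2) \<partial>lborel)"
        unfolding nn_integral_square_interval[OF lh(1)] nn_integral_square_interval[OF len_nonneg]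
        using cube_sum_le_between[OF lh(1)] c[OF l False] lh(2)
        by (intro ennreal_leI divide_right_mono) auto
      also have "\<dots> = (\<integral>\<^sup>+x\<in>{x. l < rearr x}. ennreal ((x - t)\<^sup>2) \<partial>lborel)"
      proof (rule nn_integral_cong_AE)
        show "AE x in lborel. ennreal ((x - t)\<^sup>2) * indicator {0..len l} x
          = ennreal ((x - t)\<^sup>2) * indicator {x. l < rearr x} x"
          using AE_lborel_singleton[of 0] AE_lborel_singleton[of "len l"]
          by eventually_elim (auto simp: rearr_level[OF l] indicator_def)
      qed
      finally show ?thesis .
    qed simp
    then show "(\<integral>\<^sup>+x\<in>{x. l < f x}. ennreal ((x - c)\<^sup>2) \<partial>lborel) * indicator {0<..} l
      \<le> (\<integral>\<^sup>+x\<in>{x. l < rearr x}. ennreal ((x - t)\<^sup>2) \<partial>lborel) * indicator {0<..} l"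
      by (auto simp: indicator_def[of "{0<..}"] level_def)
  qed
  also have "\<dots> = (\<integral>\<^sup>+x. ennreal ((x - t)\<^sup>2) * ennreal (rearr x) \<partial>lborel)"
    by (rule nn_integral_layer_cake[symmetric]) (auto simp: rearr_nonneg)
  finally show ?thesis by blast
qed

lemma variance_power_tradeoff:
  assumes b: "0 < b"
  shows "\<exists>t>0. (\<exists>c. (\<integral>\<^sup>+x. ennreal ((x - c)\<^sup>2) * ennreal (f x) \<partial>lborel) \<le> ennreal (t\<^sup>2)) \<and>
    (\<integral>\<^sup>+x. ennreal (f x powr (1 + b)) \<partial>lborel) \<le> ennreal (t powr - b / (1 + b))"
proof -
  interpret R: decreasing_log_concave rearr by (rule rearr_decreasing_log_concave)
  define t where "t = R.H 0 / R.G 0"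
  have t: "0 < t" using R.GH_pos by (simp add: t_def)
  obtain c where "(\<integral>\<^sup>+x. ennreal ((x - c)\<^sup>2) * ennreal (f x) \<partial>lborel)
     \<le> (\<integral>\<^sup>+x. ennreal ((x - t)\<^sup>2) * ennreal (rearr x) \<partial>lborel)"
    using second_moment_le_rearr by blast
  also have "\<dots> = (\<integral>\<^sup>+x\<in>{0..}. ennreal ((x - t)\<^sup>2 * rearr x) \<partial>lborel)"
    using rearr_nonneg by (intro nn_integral_cong) (auto simp: indicator_def ennreal_mult rearr_def)
  also have "\<dots> = ennreal (t\<^sup>2)"
    using R.second_moment_about by (simp add: t_def)
  finally have 1: "(\<integral>\<^sup>+x. ennreal ((x - c)\<^sup>2) * ennreal (f x) \<partial>lborel) \<le> ennreal (t\<^sup>2)" .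
  have "(\<integral>\<^sup>+x. ennreal (f x powr (1 + b)) \<partial>lborel) = (\<integral>\<^sup>+x. ennreal (rearr x powr (1 + b)) \<partial>lborel)"
    using b by (simp add: rearr_powr)
  also have "\<dots> = (\<integral>\<^sup>+x\<in>{0<..}. ennreal (rearr x powr (1 + b)) \<partial>lborel)"
    by (intro nn_integral_cong) (auto simp: indicator_def rearr_def)
  also have "\<dots> \<le> ennreal ((R.G 0 / R.H 0) powr b / (1 + b))"
    by (rule R.power_integral_bound[OF b])
  also have "(R.G 0 / R.H 0) powr b = t powr - b"
    using R.GH_pos by (simp add: t_def powr_minus powr_divide field_simps)
  finally show ?thesis using t 1 by blast
qed

end

section \<open>Variance and entropy\<close>

lemma exp_neg_nonneg: "0 \<le> exp_neg v"
  by (simp add: exp_neg_def)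

lemma log_concave_density_exp_neg:
  fixes V :: "real \<Rightarrow> ereal"
  assumes M: "prob_space M" and V: "ereal_convex V"
    and X: "distributed M lborel X (\<lambda>x. ennreal (exp_neg (V x)))"
  shows "log_concave_density (\<lambda>x. exp_neg (V x))"
proof
  interpret prob_space M by (rule M)
  have m: "(\<lambda>x. ennreal (exp_neg (V x))) \<in> borel_measurable lborel"
    and d: "distr M lborel X = density lborel (\<lambda>x. ennreal (exp_neg (V x)))"
    and rv: "X \<in> measurable M lborel"
    using X by (auto simp: distributed_def)
  show "(\<lambda>x. exp_neg (V x)) \<in> borel_measurable borel"
    using borel_measurable_enn2real[OF m] by (simp add: exp_neg_nonneg)
  have "emeasure (distr M lborel X) UNIV = 1"
    using rv by (simp add: emeasure_distr emeasure_space_1)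
  then show "(\<integral>\<^sup>+x. ennreal (exp_neg (V x)) \<partial>lborel) = 1"
    using m unfolding d by (simp add: emeasure_density)
  show "0 \<le> exp_neg (V x)" for x by (rule exp_neg_nonneg)
  show "exp (u * ln (exp_neg (V x)) + v * ln (exp_neg (V y))) \<le> exp_neg (V (u * x + v * y))"
    if p: "0 < exp_neg (V x)" "0 < exp_neg (V y)" and uv: "0 < u" "0 < v" "u + v = 1" for x y u v
  proof -
    have fin: "V z \<noteq> -\<infinity>" for z using V by (simp add: ereal_convex_def)
    obtain a b where ab: "V x = ereal a" "V y = ereal b"
      using p fin[of x] fin[of y] by (cases "V x"; cases "V y") (auto simp: exp_neg_def)
    have "V (u * x + v * y) \<le> ereal u * V x + ereal v * V y"
      using V uv unfolding ereal_convex_def by (meson less_imp_le)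
    then have le: "V (u * x + v * y) \<le> ereal (u * a + v * b)" by (simp add: ab)
    then obtain c where "V (u * x + v * y) = ereal c"
      using fin[of "u * x + v * y"] by (cases "V (u * x + v * y)") auto
    then show ?thesis using le by (simp add: ab exp_neg_def)
  qed
qed

text \<open>Integrability of the centred square is part of the claim because a Bochner integral that does not exist is
  \<open>0\<close>.\<close>

lemma (in prob_space) variance_le_second_moment:
  fixes X :: "'a \<Rightarrow> real"
  assumes [measurable]: "X \<in> borel_measurable M" and i: "integrable M (\<lambda>\<omega>. (X \<omega> - c)\<^sup>2)"
  shows "variance X \<le> expectation (\<lambda>\<omega>. (X \<omega> - c)\<^sup>2)"
    and "integrable M (\<lambda>\<omega>. (X \<omega> - expectation X)\<^sup>2)"
proof -
  have iY: "integrable M (\<lambda>\<omega>. X \<omega> - c)"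
  proof (rule Bochner_Integration.integrable_bound)
    show "integrable M (\<lambda>\<omega>. 1 + (X \<omega> - c)\<^sup>2)" using i by simp
    have "\<bar>y\<bar> \<le> 1 + y\<^sup>2" for y :: real
      using zero_le_power2[of "\<bar>y\<bar> - 1"] by (simp add: power2_eq_square algebra_simps)
    then show "AE \<omega> in M. norm (X \<omega> - c) \<le> norm (1 + (X \<omega> - c)\<^sup>2)" by simp
  qed measurable
  then have "integrable M (\<lambda>\<omega>. (X \<omega> - c) + c)" by (intro Bochner_Integration.integrable_add) auto
  then have iX: "integrable M X" by simp
  have e: "expectation (\<lambda>\<omega>. X \<omega> - c) = expectation X - c" using iX by (simp add: prob_space)
  have "variance X = variance (\<lambda>\<omega>. X \<omega> - c)" by (simp add: e)
  also have "\<dots> = expectation (\<lambda>\<omega>. (X \<omega> - c)\<^sup>2) - (expectation (\<lambda>\<omega>. X \<omega> - c))\<^sup>2"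
    by (rule variance_eq[OF iY i])
  finally show "variance X \<le> expectation (\<lambda>\<omega>. (X \<omega> - c)\<^sup>2)" by simp
  have eq: "(X \<omega> - expectation X)\<^sup>2
      = (X \<omega> - c)\<^sup>2 - 2 * (expectation X - c) * (X \<omega> - c) + (expectation X - c)\<^sup>2" for \<omega>
    by (simp add: power2_eq_square algebra_simps)
  show "integrable M (\<lambda>\<omega>. (X \<omega> - expectation X)\<^sup>2)"
    unfolding eq using i iY by simp
qed

text \<open>A variable of variance \<open>0\<close> would take one value almost surely, which a density excludes. Positivity is what
  makes the logarithm of the variance monotone below.\<close>

lemma (in prob_space) variance_pos_of_density:
  fixes X :: "'a \<Rightarrow> real"
  assumes X: "distributed M lborel X f" and i: "integrable M (\<lambda>\<omega>. (X \<omega> - expectation X)\<^sup>2)"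
  shows "0 < variance X"
proof -
  have rv: "X \<in> measurable M lborel" and d: "distr M lborel X = density lborel f"
    and m: "f \<in> borel_measurable lborel"
    using X by (auto simp: distributed_def)
  have "emeasure (distr M lborel X) {expectation X} = (\<integral>\<^sup>+x. f x * indicator {expectation X} x \<partial>lborel)"
    unfolding d using m by (simp add: emeasure_density)
  also have "\<dots> = (\<integral>\<^sup>+x. 0 \<partial>(lborel :: real measure))"
    by (rule nn_integral_cong_AE)
      (use AE_lborel_singleton[of "expectation X"] in \<open>auto elim!: eventually_mono\<close>)
  finally have null: "emeasure M (X -` {expectation X} \<inter> space M) = 0"
    using rv by (simp add: emeasure_distr)
  have "variance X \<noteq> 0"
  proof
    assume "variance X = 0"
    then have "AE \<omega> in M. (X \<omega> - expectation X)\<^sup>2 = 0"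
      using integral_nonneg_eq_0_iff_AE[OF i] by simp
    then have "AE \<omega> in M. X \<omega> \<in> {expectation X}" by (auto elim!: eventually_mono)
    then have "emeasure M {\<omega> \<in> space M. X \<omega> \<in> {expectation X}} = 1"
      using rv by (intro emeasure_eq_1_AE) auto
    moreover have "{\<omega> \<in> space M. X \<omega> \<in> {expectation X}} = X -` {expectation X} \<inter> space M" by auto
    ultimately show False using null by simp
  qed
  moreover have "0 \<le> variance X" by simp
  ultimately show ?thesis by linarith
qed

lemma integral_exponential_density_powr:
  assumes "0 < l" "0 < a"
  shows "(\<integral>x. exponential_density l x powr a \<partial>lborel) = l powr (a - 1) / a"
proof -
  have "has_bochner_integral lborel (exponential_density (a * l)) 1"
  proof (rule has_bochner_integral_nn_integral)
    interpret prob_space "density lborel (exponential_density (a * l))"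
      using assms by (intro prob_space_exponential_density) simp
    show "(\<integral>\<^sup>+x. ennreal (exponential_density (a * l) x) \<partial>lborel) = ennreal 1"
      using emeasure_space_1 by (simp add: emeasure_density)
  qed (use assms in \<open>auto simp: exponential_density_nonneg\<close>)
  then have 1: "(\<integral>x. exponential_density (a * l) x \<partial>lborel) = 1"
    by (simp add: has_bochner_integral_iff)
  have "exponential_density l x powr a = l powr (a - 1) / a * exponential_density (a * l) x" for x
  proof -
    have "exp (- x * l) powr a = exp (- x * (a * l))" 
      by (simp add: exp_powr_real mult.commute mult.left_commute)
    then show ?thesis
      using assms by (simp add: exponential_density_def powr_mult powr_diff)
  qed
  then show ?thesis by (simp add: 1)
qed

theorem corollary1p2:
  fixes M :: "'a measure" and X :: "'a \<Rightarrow> real" and \<alpha> :: real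
  assumes "prob_space M"
    and "\<alpha> > 1"
    and "log_concave_rv M X"
  shows "renyi_entropy \<alpha> M X \<ge> 1 / 2 * ln (prob_space.variance M X) + ln \<alpha> / (\<alpha> - 1)
    \<and> ((\<exists>l>0. distributed M lborel X (exponential_density l)) \<longrightarrow>
        renyi_entropy \<alpha> M X = 1 / 2 * ln (prob_space.variance M X) + ln \<alpha> / (\<alpha> - 1))"
proof (intro conjI impI)
  interpret prob_space M by (rule assms(1))
  define b where "b = \<alpha> - 1"
  have b: "0 < b" and \<alpha>: "\<alpha> = 1 + b" using assms(2) by (auto simp: b_def)
  obtain V where V: "ereal_convex V" and X: "distributed M lborel X (\<lambda>x. ennreal (exp_neg (V x)))"
    using assms(3) by (auto simp: log_concave_rv_def)
  define f where "f x = exp_neg (V x)" for x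
  interpret log_concave_density f
    unfolding f_def by (rule log_concave_density_exp_neg[OF assms(1) V X])
  have Xf: "distributed M lborel X (\<lambda>x. ennreal (f x))" using X by (simp add: f_def)
  have rv[measurable]: "X \<in> borel_measurable M" using X by (auto simp: distributed_def)
  obtain t c where t: "0 < t"
    and c: "(\<integral>\<^sup>+x. ennreal ((x - c)\<^sup>2) * ennreal (f x) \<partial>lborel) \<le> ennreal (t\<^sup>2)"
    and p: "(\<integral>\<^sup>+x. ennreal (f x powr (1 + b)) \<partial>lborel) \<le> ennreal (t powr - b / (1 + b))"
    using variance_power_tradeoff[OF b] by blast
  have "(\<integral>\<^sup>+\<omega>. ennreal ((X \<omega> - c)\<^sup>2) \<partial>M) \<le> ennreal (t\<^sup>2)"
    using c distributed_nn_integral[OF Xf, of "\<lambda>x. ennreal ((x - c)\<^sup>2)"] by (simp add: mult.commute)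
  then have sm: "integrable M (\<lambda>\<omega>. (X \<omega> - c)\<^sup>2)" "expectation (\<lambda>\<omega>. (X \<omega> - c)\<^sup>2) \<le> t\<^sup>2"
    by (auto intro!: integrableI_bounded integral_real_bounded simp: top_unique le_less_trans)
  have var: "0 < variance X" "variance X \<le> t\<^sup>2"
    using variance_le_second_moment[OF rv sm(1)] variance_pos_of_density[OF Xf] sm(2) by auto
  define I where "I = (\<integral>x. f x powr \<alpha> \<partial>lborel)"
  have ip: "integrable lborel (\<lambda>x. f x powr \<alpha>)"
    using p by (intro integrableI_bounded) (auto simp: \<alpha> le_less_trans)
  have I_le: "I \<le> t powr - b / (1 + b)"
    unfolding I_def using p b by (intro integral_real_bounded) (auto simp: \<alpha>)
  have I_pos: "0 < I"
  proof -
    have "I \<noteq> 0"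
    proof
      assume "I = 0"
      then have "AE x in lborel. f x powr \<alpha> = 0"
        using integral_nonneg_eq_0_iff_AE[OF ip] by (simp add: I_def)
      then have "(\<integral>\<^sup>+x. ennreal (f x) \<partial>lborel) = (\<integral>\<^sup>+x. 0 \<partial>(lborel :: real measure))"
        by (intro nn_integral_cong_AE) (auto elim!: eventually_mono)
      then show False using f_mass by simp
    qed
    moreover have "0 \<le> I" unfolding I_def by simp
    ultimately show ?thesis by linarith
  qed
  have ent: "renyi_entropy \<alpha> M X = 1 / (1 - \<alpha>) * ln I"
    unfolding I_def by (rule renyi_entropy_distributed[OF Xf f_nonneg])
  have "ln I \<le> ln (t powr - b / (1 + b))"
    using I_pos I_le by (subst ln_le_cancel_iff) auto
  also have "\<dots> = - b * ln t - ln \<alpha>"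
    using t b by (simp add: ln_div ln_powr \<alpha>)
  finally have "b * ln t + ln \<alpha> \<le> - ln I" by simp
  then have "(b * ln t + ln \<alpha>) / b \<le> - ln I / b"
    using b by (intro divide_right_mono) auto
  then have "ln t + ln \<alpha> / b \<le> - ln I / b"
    using b by (simp add: add_divide_distrib)
  moreover have "ln (variance X) \<le> 2 * ln t"
  proof -
    have "ln (variance X) \<le> ln (t\<^sup>2)" using var t by (subst ln_le_cancel_iff) auto
    then show ?thesis using t by (simp add: ln_realpow)
  qed
  moreover have "renyi_entropy \<alpha> M X = - ln I / b"
    unfolding ent b_def using assms(2) by (simp add: field_simps)
  ultimately show "renyi_entropy \<alpha> M X \<ge> 1 / 2 * ln (variance X) + ln \<alpha> / (\<alpha> - 1)"
    by (simp add: b_def)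
next
  interpret prob_space M by (rule assms(1))
  assume "\<exists>l>0. distributed M lborel X (exponential_density l)"
  then obtain l where l: "0 < l" and X: "distributed M lborel X (exponential_density l)" by blast
  have "renyi_entropy \<alpha> M X = 1 / (1 - \<alpha>) * ln (l powr (\<alpha> - 1) / \<alpha>)"
    using renyi_entropy_distributed[OF X exponential_density_nonneg[OF l]] assms(2) l
    by (simp add: integral_exponential_density_powr)
  also have "ln (l powr (\<alpha> - 1) / \<alpha>) = (\<alpha> - 1) * ln l - ln \<alpha>"
    using l assms(2) by (simp add: ln_div ln_powr)
  also have "1 / (1 - \<alpha>) * \<dots> = - ln l + ln \<alpha> / (\<alpha> - 1)"
    using assms(2) by (simp add: field_simps)
  also have "- ln l = 1 / 2 * ln (variance X)"
    unfolding exponential_distributed_variance[OF l X] using l by (simp add: ln_div ln_realpow)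
  finally show "renyi_entropy \<alpha> M X = 1 / 2 * ln (variance X) + ln \<alpha> / (\<alpha> - 1)" .
qed

end
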